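(* Let $m \in \{1, 2, 3, \ldots\} \cup \{\infty\}$ and let $X$ be a real Banach space with the following property: for every Lipschitz convex function $f : X \to \mathbb{R}$ and every $\varepsilon > 0$ there exists a convex function $h : X \to \mathbb{R}$ of class $C^m(X)$ such that $|f(x) - h(x)| \leq \varepsilon$ for all $x \in X$. Then, for every open convex set $U \subseteq X$, every continuous convex function $f : U \to \mathbb{R}$, and every $\varepsilon > 0$, there exists a convex function $g : U \to \mathbb{R}$ of class $C^m(U)$ such that $|f(x) - g(x)| \leq \varepsilon$ for all $x \in U$.
   Context: A function on an open subset $V$ of a Banach space is of class $C^m(V)$ if it is $m$ times continuously Fréchet differentiable on $V$ (for $m = \infty$: of class $C^k$ for every $k$). The function $f : U \to \mathbb{R}$ in the conclusion is not assumed to be Lipschitz or bounded on bounded sets. *)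

theory Defs
  imports "HOL-Analysis.Analysis" "HOL-Library.Extended_Nat"
begin

text \<open>
  The \<open>k\<close>-th Frechet derivative of a function \<open>X \<rightarrow> Y\<close> at a point is a bounded \<open>k\<close>-linear map
  \<open>X\<^sup>k \<rightarrow> Y\<close>. Since \<open>k\<close> varies, a \<open>k\<close>-linear map is represented by a function on lists; only its
  values on lists of length \<open>k\<close> are meaningful.
\<close>

definition mlin_bound :: "nat \<Rightarrow> real \<Rightarrow> ('a::real_normed_vector list \<Rightarrow> 'b::real_normed_vector) \<Rightarrow> bool"
  \<comment> \<open>for \<open>C \<ge> 0\<close> and \<open>k\<close>-linear \<open>M\<close>: the operator norm of \<open>M\<close> is at most \<open>C\<close>\<close>
  where "mlin_bound k C M \<longleftrightarrow>
    (\<forall>vs. length vs = k \<longrightarrow> norm (M vs) \<le> C * prod_list (map norm vs))"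

definition bounded_mlin :: "nat \<Rightarrow> ('a::real_normed_vector list \<Rightarrow> 'b::real_normed_vector) \<Rightarrow> bool"
  where "bounded_mlin k M \<longleftrightarrow>
    (\<forall>us ws. length us + length ws + 1 = k \<longrightarrow> linear (\<lambda>v. M (us @ v # ws))) \<and>
    (\<exists>C. mlin_bound k C M)"

text \<open>
  \<open>D j\<close> is the \<open>j\<close>-th derivative: \<open>D 0\<close> is \<open>f\<close>, and each map \<open>x \<mapsto> D j x\<close> with \<open>j < k\<close> is Frechet
  differentiable, for the operator norm on \<open>j\<close>-linear maps, with derivative
  \<open>h \<mapsto> D (j + 1) x (h, \<dots>)\<close>, i.e. the direction of the last differentiation is the head of the list.
  All \<open>D j\<close> are continuous in operator norm.
\<close>

definition frechet_derivs_upto :: "nat \<Rightarrow> 'a::real_normed_vector set \<Rightarrow>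
    ('a \<Rightarrow> 'b::real_normed_vector) \<Rightarrow> (nat \<Rightarrow> 'a \<Rightarrow> 'a list \<Rightarrow> 'b) \<Rightarrow> bool"
  where "frechet_derivs_upto k V f D \<longleftrightarrow>
    (\<forall>x\<in>V. D 0 x [] = f x) \<and>
    (\<forall>j\<le>k. \<forall>x\<in>V. bounded_mlin j (D j x)) \<and>
    (\<forall>j<k. \<forall>x\<in>V. \<forall>e>0. \<forall>\<^sub>F y in at x within V.
        mlin_bound j (e * norm (y - x)) (\<lambda>vs. D j y vs - D j x vs - D (Suc j) x ((y - x) # vs))) \<and>
    (\<forall>j\<le>k. \<forall>x\<in>V. \<forall>e>0. \<forall>\<^sub>F y in at x within V.
        mlin_bound j e (\<lambda>vs. D j y vs - D j x vs))"

definition Ck_on :: "nat \<Rightarrow> 'a::real_normed_vector set \<Rightarrow> ('a \<Rightarrow> 'b::real_normed_vector) \<Rightarrow> bool"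
  where "Ck_on k V f \<longleftrightarrow> (\<exists>D. frechet_derivs_upto k V f D)"

definition C_on :: "enat \<Rightarrow> 'a::real_normed_vector set \<Rightarrow> ('a \<Rightarrow> 'b::real_normed_vector) \<Rightarrow> bool"
  where "C_on m V f \<longleftrightarrow> (case m of enat k \<Rightarrow> Ck_on k V f | \<infinity> \<Rightarrow> (\<forall>k. Ck_on k V f))"

text \<open>
  \<open>Ck_on\<close> satisfies the usual recursion through the library's derivative and its
  space of bounded linear maps.
\<close>

lemma mlin_bound_Suc:
  "mlin_bound (Suc k) C M \<longleftrightarrow>
    (\<forall>vs w. length vs = k \<longrightarrow> norm (M (vs @ [w])) \<le> C * (prod_list (map norm vs) * norm w))"
proof -
  have "mlin_bound (Suc k) C M \<longleftrightarrow>
      (\<forall>vs w. length (vs @ [w]) = Suc k \<longrightarrow> norm (M (vs @ [w])) \<le> C * prod_list (map norm (vs @ [w])))"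
    unfolding mlin_bound_def length_Suc_conv_rev by blast
  then show ?thesis by simp
qed

lemma prod_list_norm_nonneg: "0 \<le> prod_list (map norm vs)"
  by (induction vs) auto

lemma mlin_bound_nonneg:
  assumes "mlin_bound k C M" shows "mlin_bound k \<bar>C\<bar> M"
  unfolding mlin_bound_def
proof (intro allI impI)
  fix vs :: "'a list" assume "length vs = k"
  with assms have "norm (M vs) \<le> C * prod_list (map norm vs)"
    by (simp add: mlin_bound_def)
  also have "\<dots> \<le> \<bar>C\<bar> * prod_list (map norm vs)"
    by (intro mult_right_mono prod_list_norm_nonneg) simp
  finally show "norm (M vs) \<le> \<bar>C\<bar> * prod_list (map norm vs)" .
qed

lemma bounded_mlin_linear:
  assumes "bounded_mlin k M" "length us + length ws + 1 = k"
  shows "linear (\<lambda>v. M (us @ v # ws))"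
  using assms unfolding bounded_mlin_def by blast

lemma Ck_on_0: "Ck_on 0 V f \<longleftrightarrow> continuous_on V f"
proof -
  have *: "continuous_on V f \<longleftrightarrow>
      (\<forall>x\<in>V. \<forall>e>0. \<forall>\<^sub>F y in at x within V. norm (f y - f x) \<le> e)" (is "?L \<longleftrightarrow> ?R")
  proof
    assume L: ?L
    show ?R
    proof (intro ballI allI impI)
      fix x e assume "x \<in> V" "(e::real) > 0"
      then have "\<forall>\<^sub>F y in at x within V. norm (f y - f x) < e"
        using L unfolding continuous_on tendsto_iff dist_norm by auto
      then show "\<forall>\<^sub>F y in at x within V. norm (f y - f x) \<le> e"
        by eventually_elim simp
    qed
  next
    assume R: ?R
    show ?L unfolding continuous_on tendsto_iff dist_norm
    proof (intro ballI allI impI)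
      fix x e assume "x \<in> V" "(e::real) > 0"
      then have "\<forall>\<^sub>F y in at x within V. norm (f y - f x) \<le> e / 2"
        using R half_gt_zero by blast
      then show "\<forall>\<^sub>F y in at x within V. norm (f y - f x) < e"
        by eventually_elim (use \<open>e > 0\<close> in linarith)
    qed
  qed
  have ev: "(\<forall>\<^sub>F y in at x within V. norm (g y - g x) \<le> e) \<longleftrightarrow>
        (\<forall>\<^sub>F y in at x within V. norm (f y - f x) \<le> e)"
    if "x \<in> V" "\<forall>x\<in>V. g x = f x" for g x e
    using that by (auto simp: eventually_at_filter elim!: eventually_mono)
  show ?thesis
  proof
    assume "Ck_on 0 V f"
    then obtain D where D: "\<forall>x\<in>V. D (0::nat) x [] = f x"
      and c: "\<forall>x\<in>V. \<forall>e>0. \<forall>\<^sub>F y in at x within V. norm (D 0 y [] - D 0 x []) \<le> e"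
      unfolding Ck_on_def frechet_derivs_upto_def mlin_bound_def by auto
    show "continuous_on V f"
      unfolding * using c ev[of _ "\<lambda>x. D 0 x []"] D by auto
  next
    assume "continuous_on V f"
    then show "Ck_on 0 V f"
      unfolding * Ck_on_def frechet_derivs_upto_def
      by (intro exI[of _ "\<lambda>j x vs. f x"]) (auto simp: mlin_bound_def bounded_mlin_def)
  qed
qed

lemma Ck_on_Suc:
  fixes f :: "'a::real_normed_vector \<Rightarrow> 'b::real_normed_vector"
  assumes "open V"
  shows "Ck_on (Suc k) V f \<longleftrightarrow>
    (\<exists>f' :: 'a \<Rightarrow> 'a \<Rightarrow>\<^sub>L 'b. (\<forall>x\<in>V. (f has_derivative blinfun_apply (f' x)) (at x)) \<and> Ck_on k V f')"
proof
  assume "Ck_on (Suc k) V f"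
  then obtain D where D: "frechet_derivs_upto (Suc k) V f D"
    unfolding Ck_on_def by blast
  have
    D0: "\<And>x. x \<in> V \<Longrightarrow> D 0 x [] = f x" and
    Dm: "\<And>j x. j \<le> Suc k \<Longrightarrow> x \<in> V \<Longrightarrow> bounded_mlin j (D j x)" and
    Dd: "\<And>j x e. j < Suc k \<Longrightarrow> x \<in> V \<Longrightarrow> 0 < e \<Longrightarrow> \<forall>\<^sub>F y in at x within V.
      mlin_bound j (e * norm (y - x)) (\<lambda>vs. D j y vs - D j x vs - D (Suc j) x ((y - x) # vs))" and
    Dc: "\<And>j x e. j \<le> Suc k \<Longrightarrow> x \<in> V \<Longrightarrow> 0 < e \<Longrightarrow> \<forall>\<^sub>F y in at x within V.
      mlin_bound j e (\<lambda>vs. D j y vs - D j x vs)"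
    using D unfolding frechet_derivs_upto_def by blast+
  define E where "E j x vs = Blinfun (\<lambda>w. D (Suc j) x (vs @ [w]))" for j x vs
  have E: "blinfun_apply (E j x vs) w = D (Suc j) x (vs @ [w])"
    if "j \<le> k" "x \<in> V" "length vs = j" for j x vs w
  proof -
    from Dm[of "Suc j" x] that obtain C where
      lin: "linear (\<lambda>v. D (Suc j) x (vs @ [v]))" and C: "mlin_bound (Suc j) C (D (Suc j) x)"
      using bounded_mlin_linear[of "Suc j" "D (Suc j) x" vs "[]"] unfolding bounded_mlin_def by auto
    have "bounded_linear (\<lambda>w. D (Suc j) x (vs @ [w]))"
      using C that(3) lin unfolding mlin_bound_Suc
      by (intro bounded_linear_intro[where K = "C * prod_list (map norm vs)"])
         (use linear_add[OF lin] linear_scale[OF lin] in \<open>auto simp: mult_ac\<close>)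
    then show ?thesis by (simp add: E_def bounded_linear_Blinfun_apply)
  qed
  have Eb: "norm (e :: 'a \<Rightarrow>\<^sub>L 'b) \<le> C * prod_list (map norm vs)"
    if "mlin_bound (Suc j) C M" "0 \<le> C" "length vs = j" "\<And>w. blinfun_apply e w = M (vs @ [w])" for e C M j vs
    using that by (intro norm_blinfun_bound) (auto simp: mlin_bound_Suc prod_list_norm_nonneg mult_ac)
  have evV: "\<forall>\<^sub>F y in at x within V. y \<in> V" for x
    by (simp add: eventually_at_filter)
  have "(f has_derivative blinfun_apply (E 0 x [])) (at x)" if x: "x \<in> V" for x
  proof -
    have "\<forall>\<^sub>F y in at x within V. norm (f y - f x - blinfun_apply (E 0 x []) (y - x)) \<le> e * norm (y - x)" if "e > 0" for e
      using Dd[OF zero_less_Suc x that] evV[of x]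
    proof eventually_elim
      case (elim y)
      then show ?case using x D0 E[of 0 x "[]"] by (simp add: mlin_bound_def)
    qed
    then have "(f has_derivative blinfun_apply (E 0 x [])) (at x within V)"
      unfolding has_derivative_within_alt2 using blinfun.bounded_linear_right by blast
    then show ?thesis by (simp add: at_within_open[OF x assms])
  qed
  moreover have "Ck_on k V (\<lambda>x. E 0 x [])"
    unfolding Ck_on_def frechet_derivs_upto_def
  proof (intro exI[of _ E] conjI allI ballI impI)
    fix j x assume j: "j \<le> k" and x: "x \<in> V"
    show "bounded_mlin j (E j x)"
      unfolding bounded_mlin_def
    proof (intro conjI allI impI)
      fix us ws :: "'a list" assume l: "length us + length ws + 1 = j"
      have lin: "linear (\<lambda>v. D (Suc j) x (us @ v # (ws @ [w])))" for w
        by (rule bounded_mlin_linear[OF Dm]) (use j x l in auto)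
      show "linear (\<lambda>v. E j x (us @ v # ws))"
        by (rule linearI; rule blinfun_eqI)
           (use E j x l linear_add[OF lin] linear_scale[OF lin] in \<open>auto simp: blinfun.bilinear_simps\<close>)
    next
      from Dm[of "Suc j" x] j x obtain C where "mlin_bound (Suc j) C (D (Suc j) x)"
        unfolding bounded_mlin_def by auto
      from mlin_bound_nonneg[OF this] show "\<exists>C. mlin_bound j C (E j x)"
        unfolding mlin_bound_def[of j]
        by (intro exI[of _ "\<bar>C\<bar>"] allI impI Eb) (use E j x in auto)
    qed
  next
    fix j x and e :: real assume j: "j < k" and x: "x \<in> V" and e: "e > 0"
    from j have "Suc j < Suc k" by simp
    from Dd[OF this x e] evV
    show "\<forall>\<^sub>F y in at x within V. mlin_bound j (e * norm (y - x))
         (\<lambda>vs. E j y vs - E j x vs - E (Suc j) x ((y - x) # vs))"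
    proof eventually_elim
      case (elim y)
      show ?case unfolding mlin_bound_def[of j]
        by (intro allI impI Eb[OF elim(1)]) (use e j x elim(2) E in \<open>auto simp: blinfun.bilinear_simps\<close>)
    qed
  next
    fix j x and e :: real assume j: "j \<le> k" and x: "x \<in> V" and e: "e > 0"
    from j have "Suc j \<le> Suc k" by simp
    from Dc[OF this x e] evV
    show "\<forall>\<^sub>F y in at x within V. mlin_bound j e (\<lambda>vs. E j y vs - E j x vs)"
    proof eventually_elim
      case (elim y)
      show ?case unfolding mlin_bound_def[of j]
        by (intro allI impI Eb[OF elim(1)]) (use e j x elim(2) E in \<open>auto simp: blinfun.bilinear_simps\<close>)
    qed
  qed simp
  ultimately show "\<exists>f' :: 'a \<Rightarrow> 'a \<Rightarrow>\<^sub>L 'b. (\<forall>x\<in>V. (f has_derivative blinfun_apply (f' x)) (at x)) \<and> Ck_on k V f'"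
    by (intro exI[of _ "\<lambda>x. E 0 x []"] conjI ballI)
next
  assume "\<exists>f' :: 'a \<Rightarrow> 'a \<Rightarrow>\<^sub>L 'b. (\<forall>x\<in>V. (f has_derivative blinfun_apply (f' x)) (at x)) \<and> Ck_on k V f'"
  then obtain f' :: "'a \<Rightarrow> 'a \<Rightarrow>\<^sub>L 'b" and E where
    f': "\<And>x. x \<in> V \<Longrightarrow> (f has_derivative blinfun_apply (f' x)) (at x)" and
    E: "frechet_derivs_upto k V f' E"
    unfolding Ck_on_def by blast
  have
    E0: "\<And>x. x \<in> V \<Longrightarrow> E 0 x [] = f' x" and
    Em: "\<And>j x. j \<le> k \<Longrightarrow> x \<in> V \<Longrightarrow> bounded_mlin j (E j x)" and
    Ed: "\<And>j x e. j < k \<Longrightarrow> x \<in> V \<Longrightarrow> 0 < e \<Longrightarrow> \<forall>\<^sub>F y in at x within V.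
      mlin_bound j (e * norm (y - x)) (\<lambda>vs. E j y vs - E j x vs - E (Suc j) x ((y - x) # vs))" and
    Ec: "\<And>j x e. j \<le> k \<Longrightarrow> x \<in> V \<Longrightarrow> 0 < e \<Longrightarrow> \<forall>\<^sub>F y in at x within V.
      mlin_bound j e (\<lambda>vs. E j y vs - E j x vs)"
    using E unfolding frechet_derivs_upto_def by simp_all
  define D where "D j x vs = (if j = 0 then f x else blinfun_apply (E (j - 1) x (butlast vs)) (last vs))"
    for j x vs
  have D_Suc: "D (Suc j) x (vs @ [w]) = blinfun_apply (E j x vs) w" for j x vs w
    by (simp add: D_def)
  have D_Cons: "D (Suc (Suc j)) x (v # vs @ [w]) = blinfun_apply (E (Suc j) x (v # vs)) w" for j x v vs w
    using D_Suc[of "Suc j" x "v # vs" w] by simp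
  have Db: "mlin_bound (Suc j) C M"
    if "mlin_bound j C e" "\<And>vs w. length vs = j \<Longrightarrow> M (vs @ [w]) = blinfun_apply (e vs) w"
    for j C and M :: "'a list \<Rightarrow> 'b" and e :: "'a list \<Rightarrow> 'a \<Rightarrow>\<^sub>L 'b"
    unfolding mlin_bound_Suc
  proof (intro allI impI)
    fix vs :: "'a list" and w assume l: "length vs = j"
    have "norm (blinfun_apply (e vs) w) \<le> norm (e vs) * norm w" by (rule norm_blinfun)
    also have "\<dots> \<le> C * prod_list (map norm vs) * norm w"
      using that(1) l unfolding mlin_bound_def by (intro mult_right_mono) auto
    finally show "norm (M (vs @ [w])) \<le> C * (prod_list (map norm vs) * norm w)"
      using that(2) l by (simp add: mult_ac)
  qed
  have cont: "continuous_on V f"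
    by (intro continuous_at_imp_continuous_on ballI has_derivative_continuous[OF f'])
  show "Ck_on (Suc k) V f"
    unfolding Ck_on_def frechet_derivs_upto_def
  proof (intro exI[of _ D] conjI allI ballI impI)
    fix j x assume j: "j \<le> Suc k" and x: "x \<in> V"
    show "bounded_mlin j (D j x)"
    proof (cases j)
      case 0
      then show ?thesis by (auto simp: bounded_mlin_def mlin_bound_def D_def)
    next
      case (Suc i)
      with j have i: "i \<le> k" by simp
      show ?thesis unfolding bounded_mlin_def
      proof (intro conjI allI impI)
        fix us ws :: "'a list" assume l: "length us + length ws + 1 = j"
        show "linear (\<lambda>v. D j x (us @ v # ws))"
        proof (cases ws rule: rev_cases)
          case Nil
          then show ?thesis unfolding Suc
            using bounded_linear.linear[OF blinfun.bounded_linear_right[of "E i x us"]] by (simp add: D_Suc)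
        next
          case (snoc ws' w)
          have lin: "linear (\<lambda>v. E i x (us @ v # ws'))"
            by (rule bounded_mlin_linear[OF Em[OF i x]]) (use l Suc snoc in auto)
          have "D j x (us @ v # ws) = blinfun_apply (E i x (us @ v # ws')) w" for v
            using D_Suc[of i x "us @ v # ws'" w] unfolding Suc snoc by simp
          then show ?thesis
            by (intro linearI) (auto simp: linear_add[OF lin] linear_scale[OF lin] blinfun.bilinear_simps)
        qed
      next
        from Em[OF i x] obtain C where "mlin_bound i C (E i x)" unfolding bounded_mlin_def by auto
        then show "\<exists>C. mlin_bound j C (D j x)" unfolding Suc using Db D_Suc by blast
      qed
    qed
  next
    fix j x and e :: real assume j: "j < Suc k" and x: "x \<in> V" and e: "e > 0"
    show "\<forall>\<^sub>F y in at x within V. mlin_bound j (e * norm (y - x))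
         (\<lambda>vs. D j y vs - D j x vs - D (Suc j) x ((y - x) # vs))"
    proof (cases j)
      case 0
      have "(f has_derivative blinfun_apply (E 0 x [])) (at x within V)"
        using f'[OF x] E0[OF x] has_derivative_at_withinI by metis
      then have "\<forall>\<^sub>F y in at x within V. norm (f y - f x - blinfun_apply (E 0 x []) (y - x)) \<le> e * norm (y - x)"
        unfolding has_derivative_within_alt2 using e by blast
      then show ?thesis by (simp add: 0 mlin_bound_def D_def)
    next
      case (Suc i)
      with j have "i < k" by simp
      from Ed[OF this x e] show ?thesis unfolding Suc
        by eventually_elim (erule Db, simp add: D_Suc D_Cons blinfun.bilinear_simps)
    qed
  next
    fix j x and e :: real assume j: "j \<le> Suc k" and x: "x \<in> V" and e: "e > 0"
    show "\<forall>\<^sub>F y in at x within V. mlin_bound j e (\<lambda>vs. D j y vs - D j x vs)"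
    proof (cases j)
      case 0
      have "\<forall>\<^sub>F y in at x within V. dist (f y) (f x) < e"
        using cont x e unfolding continuous_on tendsto_iff by blast
      then show ?thesis
        by eventually_elim (simp add: 0 mlin_bound_def D_def dist_norm)
    next
      case (Suc i)
      with j have "i \<le> k" by simp
      from Ec[OF this x e] show ?thesis unfolding Suc
        by eventually_elim (erule Db, simp add: D_Suc blinfun.bilinear_simps)
    qed
  qed (simp add: D_def)
qed

end

theory Submission
  imports Defs
begin

text \<open>
  Two facts make the theorem work: a continuous convex function coincides locally with Lipschitz convex
  functions on the whole space, and convex functions can be glued with a smooth maximum.
  
  For \<open>L \<ge> 0\<close> let \<open>E\<^sub>L\<close> (\<open>slope_region\<close>) be the set of all \<open>x\<close> in \<open>U\<close> with \<open>f y \<ge> f x - L \<parallel>y - x\<parallel>\<close> for all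
  \<open>y\<close> in \<open>U\<close>. These sets grow with \<open>L\<close>, and their interiors cover \<open>U\<close>, because \<open>f\<close> is convex and locally
  bounded (\<open>ball_subset_slope_region\<close>). The infimal convolution \<open>f\<^sub>L\<close> of \<open>f\<close> with \<open>L \<parallel>\<cdot>\<parallel>\<close>
  (\<open>lipschitz_envelope\<close>) is convex and \<open>L\<close>-Lipschitz on the whole space, lies below \<open>f\<close> on \<open>U\<close>, and equals
  \<open>f\<close> on \<open>E\<^sub>L\<close>.
  
  Take slopes increasing to infinity, and write \<open>E\<^sub>i\<close> and \<open>f\<^sub>i\<close> for the corresponding sets and
  functions. The hypothesis approximates \<open>f\<^sub>i + a\<^sub>i\<close> by a convex \<open>h\<^sub>i\<close> of class \<open>C\<^sup>m\<close> up to the error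
  \<open>a\<^sub>i / 8\<close>, where \<open>a\<^sub>i = \<epsilon> / 2\<^sup>i\<^sup>+\<^sup>1\<close>. Put \<open>G\<^sub>0 = h\<^sub>0\<close> and let \<open>G\<^sub>i\<^sub>+\<^sub>1\<close> be a smooth maximum of \<open>G\<^sub>i\<close> and
  \<open>h\<^sub>i\<^sub>+\<^sub>1\<close>. Since \<open>f\<^sub>i\<close> and \<open>f\<^sub>i\<^sub>+\<^sub>1\<close> agree on \<open>E\<^sub>i\<close> and the offsets \<open>a\<^sub>i\<close> decrease, \<open>h\<^sub>i\<^sub>+\<^sub>1\<close> lies below \<open>h\<^sub>i\<close>
  there, and below \<open>G\<^sub>i \<ge> h\<^sub>i\<close>, with enough room for the smooth maximum to be exactly \<open>G\<^sub>i\<close>. Hence the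
  sequence is constant on \<open>E\<^sub>i\<close> from index \<open>i\<close> on, and its limit is convex and of class \<open>C\<^sup>m\<close> on \<open>U\<close>
  (\<open>eventually_constant_limit\<close>). It lies
  above \<open>f\<close>, since \<open>h\<^sub>i \<ge> f\<close> on \<open>E\<^sub>i\<close>, and below \<open>f + \<epsilon>\<close>, since every \<open>f\<^sub>i\<close> lies below \<open>f\<close> on \<open>U\<close>.
  
  The smooth maximum is \<open>x + \<psi>(y - x + c)\<close> with \<open>\<psi> s = s exp(-c/s)\<close> for \<open>s > 0\<close> and \<open>\<psi> s = 0\<close> otherwise: a
  convex smooth function on the real line with slope between 0 and 1. That it preserves the class
  \<open>C\<^sup>m\<close> rests on a Leibniz rule and a chain rule for iterated Frechet derivatives
  (\<open>mlin_Ck_shuffle_product\<close>, \<open>mlin_Ck_compose\<close>).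
\<close>

section \<open>Calculus of iterated Frechet derivatives\<close>

text \<open>
  The calculus of \<open>C\<^sup>k\<close> functions is developed for maps with values in the \<open>j\<close>-linear maps, all of
  them represented by functions on lists. Differentiation then raises \<open>j\<close> and keeps the HOL type,
  so induction on the order of differentiability is possible. The recursion \<open>Ck_on_Suc\<close> changes
  the codomain to a space of bounded linear maps and so does not support such inductions.
\<close>
definition mlin_continuous :: "nat \<Rightarrow> 'a set \<Rightarrow> ('a::real_normed_vector \<Rightarrow> 'a list \<Rightarrow> 'b::real_normed_vector) \<Rightarrow> bool"
  where "mlin_continuous j V A \<longleftrightarrow> (\<forall>x\<in>V. bounded_mlin j (A x)) \<and>
    (\<forall>x\<in>V. \<forall>e>0. \<forall>\<^sub>F y in at x within V. mlin_bound j e (\<lambda>vs. A y vs - A x vs))"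

definition mlin_derivative :: "nat \<Rightarrow> 'a set \<Rightarrow> ('a::real_normed_vector \<Rightarrow> 'a list \<Rightarrow> 'b::real_normed_vector)
    \<Rightarrow> ('a \<Rightarrow> 'a list \<Rightarrow> 'b) \<Rightarrow> bool"
  where "mlin_derivative j V A A' \<longleftrightarrow> (\<forall>x\<in>V. \<forall>e>0. \<forall>\<^sub>F y in at x within V.
    mlin_bound j (e * norm (y - x)) (\<lambda>vs. A y vs - A x vs - A' x ((y - x) # vs)))"

primrec mlin_Ck :: "nat \<Rightarrow> nat \<Rightarrow> 'a set \<Rightarrow> ('a::real_normed_vector \<Rightarrow> 'a list \<Rightarrow> 'b::real_normed_vector) \<Rightarrow> bool"
  where
    "mlin_Ck 0 j V A \<longleftrightarrow> mlin_continuous j V A"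
  | "mlin_Ck (Suc k) j V A \<longleftrightarrow> mlin_continuous j V A \<and>
      (\<exists>A'. mlin_derivative j V A A' \<and> mlin_Ck k (Suc j) V A')"

lemma mlin_Ck_continuous: "mlin_Ck k j V A \<Longrightarrow> mlin_continuous j V A"
  by (cases k) auto

lemma mlin_Ck_SucD: "mlin_Ck (Suc k) j V A \<Longrightarrow> mlin_Ck k j V A"
proof (induction k arbitrary: j A)
  case (Suc k)
  then show ?case by (subst mlin_Ck.simps) (meson mlin_Ck.simps(2))
qed simp

lemma mlin_Ck_mono: "mlin_Ck k j V A \<Longrightarrow> l \<le> k \<Longrightarrow> mlin_Ck l j V A"
  by (induction k) (auto simp: le_Suc_eq dest: mlin_Ck_SucD simp del: mlin_Ck.simps)

text \<open>
  Unfolding the recursion collects the successive witnesses \<open>A'\<close> into the single family of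
  derivatives on which \<open>Ck_on\<close> is based.
\<close>
lemma mlin_Ck_iff_chain:
  "mlin_Ck k j V A \<longleftrightarrow> (\<exists>D. D 0 = A \<and> (\<forall>i\<le>k. mlin_continuous (j + i) V (D i)) \<and>
     (\<forall>i<k. mlin_derivative (j + i) V (D i) (D (Suc i))))"
proof (induction k arbitrary: j A)
  case 0
  show ?case by auto
next
  case (Suc k)
  show ?case
  proof
    assume "mlin_Ck (Suc k) j V A"
    then obtain A' where A: "mlin_continuous j V A" "mlin_derivative j V A A'" "mlin_Ck k (Suc j) V A'"
      by auto
    then obtain D where D: "D 0 = A'" "\<forall>i\<le>k. mlin_continuous (Suc j + i) V (D i)"
      "\<forall>i<k. mlin_derivative (Suc j + i) V (D i) (D (Suc i))"
      unfolding Suc.IH by blast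
    define E where "E = case_nat A D"
    have "mlin_continuous (j + i) V (E i)" if "i \<le> Suc k" for i
      using A D that by (cases i) (auto simp: E_def)
    moreover have "mlin_derivative (j + i) V (E i) (E (Suc i))" if "i < Suc k" for i
      using A D that by (cases i) (auto simp: E_def)
    moreover have "E 0 = A" by (simp add: E_def)
    ultimately show "\<exists>D. D 0 = A \<and> (\<forall>i\<le>Suc k. mlin_continuous (j + i) V (D i)) \<and>
       (\<forall>i<Suc k. mlin_derivative (j + i) V (D i) (D (Suc i)))" by blast
  next
    assume "\<exists>D. D 0 = A \<and> (\<forall>i\<le>Suc k. mlin_continuous (j + i) V (D i)) \<and>
       (\<forall>i<Suc k. mlin_derivative (j + i) V (D i) (D (Suc i)))"
    then obtain D where D: "D 0 = A" "\<And>i. i \<le> Suc k \<Longrightarrow> mlin_continuous (j + i) V (D i)"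
       "\<And>i. i < Suc k \<Longrightarrow> mlin_derivative (j + i) V (D i) (D (Suc i))" by blast
    have "mlin_Ck k (Suc j) V (D (Suc 0))"
      unfolding Suc.IH using D(2)[of "Suc _"] D(3)[of "Suc _"]
      by (intro exI[of _ "\<lambda>i. D (Suc i)"]) auto
    then show "mlin_Ck (Suc k) j V A"
      using D(1) D(2)[of 0] D(3)[of 0] by auto
  qed
qed

lemma mlin_bound_cong:
  "(\<And>vs. length vs = k \<Longrightarrow> M vs = N vs) \<Longrightarrow> mlin_bound k C M \<longleftrightarrow> mlin_bound k C N"
  by (simp add: mlin_bound_def)

lemma bounded_mlin_cong:
  assumes "\<And>vs. length vs = k \<Longrightarrow> M vs = N vs"
  shows "bounded_mlin k M \<longleftrightarrow> bounded_mlin k N"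
proof -
  have "(\<lambda>v. M (us @ v # ws)) = (\<lambda>v. N (us @ v # ws))" if "length us + length ws + 1 = k" for us ws
    using that assms by auto
  then show ?thesis
    unfolding bounded_mlin_def using mlin_bound_cong[of k M N] assms by auto
qed

lemma eventually_in_at_within: "\<forall>\<^sub>F y in at x within V. y \<in> V"
  by (simp add: eventually_at_filter)

lemma mlin_continuous_cong:
  assumes "\<And>x vs. x \<in> V \<Longrightarrow> length vs = j \<Longrightarrow> A x vs = B x vs"
    and "mlin_continuous j V A"
  shows "mlin_continuous j V B"
  unfolding mlin_continuous_def
proof (intro conjI ballI allI impI)
  fix x assume x: "x \<in> V"
  then show "bounded_mlin j (B x)"
    using assms bounded_mlin_cong[of j "A x" "B x"] unfolding mlin_continuous_def by blast
  fix e :: real assume "e > 0"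
  with x assms(2) have "\<forall>\<^sub>F y in at x within V. mlin_bound j e (\<lambda>vs. A y vs - A x vs)"
    unfolding mlin_continuous_def by blast
  with eventually_in_at_within
  show "\<forall>\<^sub>F y in at x within V. mlin_bound j e (\<lambda>vs. B y vs - B x vs)"
    by eventually_elim (use x assms(1) in \<open>auto simp: mlin_bound_def\<close>)
qed

lemma mlin_derivative_cong:
  assumes "\<And>x vs. x \<in> V \<Longrightarrow> length vs = j \<Longrightarrow> A x vs = B x vs"
    and "\<And>x vs. x \<in> V \<Longrightarrow> length vs = Suc j \<Longrightarrow> A' x vs = B' x vs"
    and "mlin_derivative j V A A'"
  shows "mlin_derivative j V B B'"
  unfolding mlin_derivative_def
proof (intro ballI allI impI)
  fix x and e :: real assume x: "x \<in> V" and "e > 0"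
  with assms(3) have "\<forall>\<^sub>F y in at x within V. mlin_bound j (e * norm (y - x)) (\<lambda>vs. A y vs - A x vs - A' x ((y - x) # vs))"
    unfolding mlin_derivative_def by blast
  with eventually_in_at_within
  show "\<forall>\<^sub>F y in at x within V. mlin_bound j (e * norm (y - x)) (\<lambda>vs. B y vs - B x vs - B' x ((y - x) # vs))"
    by eventually_elim (use x assms(1,2) in \<open>auto simp: mlin_bound_def\<close>)
qed

lemma mlin_Ck_cong:
  assumes "\<And>x vs. x \<in> V \<Longrightarrow> length vs = j \<Longrightarrow> A x vs = B x vs"
    and "mlin_Ck k j V A"
  shows "mlin_Ck k j V B"
  using assms
proof (cases k)
  case 0
  then show ?thesis using assms mlin_continuous_cong[of V j A B] by auto
next
  case (Suc l)
  then show ?thesis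
    using assms mlin_continuous_cong[of V j A B] mlin_derivative_cong[of V j A B] by auto blast
qed

lemma Ck_on_iff_mlin_Ck: "Ck_on k V f \<longleftrightarrow> mlin_Ck k 0 V (\<lambda>x _. f x)"
proof
  assume "Ck_on k V f"
  then obtain D where D: "frechet_derivs_upto k V f D" unfolding Ck_on_def by blast
  then have "mlin_Ck k 0 V (D 0)"
    unfolding mlin_Ck_iff_chain frechet_derivs_upto_def mlin_continuous_def mlin_derivative_def
    by (intro exI[of _ D]) auto
  then show "mlin_Ck k 0 V (\<lambda>x _. f x)"
    by (rule mlin_Ck_cong[rotated]) (use D in \<open>auto simp: frechet_derivs_upto_def\<close>)
next
  assume "mlin_Ck k 0 V (\<lambda>x _. f x)"
  then obtain D where "D 0 = (\<lambda>x _. f x)" "\<forall>i\<le>k. mlin_continuous i V (D i)"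
     "\<forall>i<k. mlin_derivative i V (D i) (D (Suc i))"
    unfolding mlin_Ck_iff_chain by auto
  then show "Ck_on k V f"
    unfolding Ck_on_def frechet_derivs_upto_def mlin_continuous_def mlin_derivative_def
    by (intro exI[of _ D]) auto
qed

lemma mlin_Ck_subset:
  assumes "W \<subseteq> V" "mlin_Ck k j V A"
  shows "mlin_Ck k j W A"
proof -
  have ev: "eventually P (at x within W)" if "eventually P (at x within V)" for P x
    using that at_le[OF assms(1)] by (rule filter_leD[rotated])
  have c: "mlin_continuous j W A" if "mlin_continuous j V A" for j A
    using that assms(1) ev unfolding mlin_continuous_def by blast
  have d: "mlin_derivative j W A A'" if "mlin_derivative j V A A'" for j A A'
    using that assms(1) ev unfolding mlin_derivative_def by blast
  show ?thesis
    using assms(2) by (induction k arbitrary: j A) (auto intro: c d)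
qed

lemma mlin_bound_add:
  assumes "mlin_bound k C M" "mlin_bound k D N"
  shows "mlin_bound k (C + D) (\<lambda>vs. M vs + N vs)"
  using assms unfolding mlin_bound_def
  by (simp add: distrib_right norm_triangle_mono)

lemma mlin_bound_minus: "mlin_bound k C (\<lambda>vs. - M vs) \<longleftrightarrow> mlin_bound k C M"
  by (simp add: mlin_bound_def)

lemma bounded_mlin_add:
  assumes "bounded_mlin k M" "bounded_mlin k N"
  shows "bounded_mlin k (\<lambda>vs. M vs + N vs)"
  unfolding bounded_mlin_def
proof (intro conjI allI impI)
  show "linear (\<lambda>v. M (us @ v # ws) + N (us @ v # ws))" if "length us + length ws + 1 = k" for us ws
    using assms that by (intro linear_compose_add bounded_mlin_linear)
  show "\<exists>C. mlin_bound k C (\<lambda>vs. M vs + N vs)"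
    using assms mlin_bound_add unfolding bounded_mlin_def by blast
qed

lemma bounded_mlin_minus:
  assumes "bounded_mlin k M"
  shows "bounded_mlin k (\<lambda>vs. - M vs)"
  using assms linear_compose_neg unfolding bounded_mlin_def mlin_bound_minus by blast

lemma mlin_Ck_add:
  assumes "mlin_Ck k j V A" "mlin_Ck k j V B"
  shows "mlin_Ck k j V (\<lambda>x vs. A x vs + B x vs)"
proof -
  have c: "mlin_continuous j V (\<lambda>x vs. A x vs + B x vs)"
    if "mlin_continuous j V A" "mlin_continuous j V B" for j A B
    unfolding mlin_continuous_def
  proof (intro conjI ballI allI impI)
    fix x assume x: "x \<in> V"
    then show "bounded_mlin j (\<lambda>vs. A x vs + B x vs)"
      using that bounded_mlin_add unfolding mlin_continuous_def by blast
    fix e :: real assume "e > 0"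
    then have "\<forall>\<^sub>F y in at x within V. mlin_bound j (e/2) (\<lambda>vs. A y vs - A x vs)"
         "\<forall>\<^sub>F y in at x within V. mlin_bound j (e/2) (\<lambda>vs. B y vs - B x vs)"
      using that x half_gt_zero unfolding mlin_continuous_def by blast+
    then show "\<forall>\<^sub>F y in at x within V. mlin_bound j e (\<lambda>vs. A y vs + B y vs - (A x vs + B x vs))"
    proof eventually_elim
      case (elim y)
      show ?case using mlin_bound_add[OF elim] by (simp add: algebra_simps)
    qed
  qed
  have d: "mlin_derivative j V (\<lambda>x vs. A x vs + B x vs) (\<lambda>x vs. A' x vs + B' x vs)"
    if "mlin_derivative j V A A'" "mlin_derivative j V B B'" for j A B A' B'
    unfolding mlin_derivative_def
  proof (intro ballI allI impI)
    fix x and e :: real assume x: "x \<in> V" and "e > 0"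
    then have "\<forall>\<^sub>F y in at x within V. mlin_bound j (e/2 * norm (y - x)) (\<lambda>vs. A y vs - A x vs - A' x ((y - x) # vs))"
         "\<forall>\<^sub>F y in at x within V. mlin_bound j (e/2 * norm (y - x)) (\<lambda>vs. B y vs - B x vs - B' x ((y - x) # vs))"
      using that half_gt_zero unfolding mlin_derivative_def by blast+
    then show "\<forall>\<^sub>F y in at x within V. mlin_bound j (e * norm (y - x))
        (\<lambda>vs. A y vs + B y vs - (A x vs + B x vs) - (A' x ((y - x) # vs) + B' x ((y - x) # vs)))"
    proof eventually_elim
      case (elim y)
      show ?case using mlin_bound_add[OF elim] by (simp add: algebra_simps)
    qed
  qed
  show ?thesis
    using assms
  proof (induction k arbitrary: j A B)
    case 0
    then show ?case by (simp add: c)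
  next
    case (Suc k)
    then obtain A' B' where "mlin_derivative j V A A'" "mlin_Ck k (Suc j) V A'"
       "mlin_derivative j V B B'" "mlin_Ck k (Suc j) V B'" by auto
    with Suc show ?case using c d by (auto intro!: exI[of _ "\<lambda>x vs. A' x vs + B' x vs"])
  qed
qed

lemma mlin_Ck_minus:
  assumes "mlin_Ck k j V A"
  shows "mlin_Ck k j V (\<lambda>x vs. - A x vs)"
proof -
  have c: "mlin_continuous j V (\<lambda>x vs. - A x vs)"
    if "mlin_continuous j V A" for j and A :: "'a \<Rightarrow> 'a list \<Rightarrow> 'b"
  proof -
    have "(\<lambda>vs. - A y vs - - A x vs) = (\<lambda>vs. - (A y vs - A x vs))" for x y
      by auto
    with that bounded_mlin_minus[of j] show ?thesis
      unfolding mlin_continuous_def by (simp only: mlin_bound_minus) blast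
  qed
  have d: "mlin_derivative j V (\<lambda>x vs. - A x vs) (\<lambda>x vs. - A' x vs)"
    if "mlin_derivative j V A A'" for j and A A' :: "'a \<Rightarrow> 'a list \<Rightarrow> 'b"
  proof -
    have "(\<lambda>vs. - A y vs - - A x vs - - A' x ((y - x) # vs)) = (\<lambda>vs. - (A y vs - A x vs - A' x ((y - x) # vs)))" for x y
      by auto
    with that show ?thesis unfolding mlin_derivative_def by (simp only: mlin_bound_minus)
  qed
  show ?thesis
    using assms
  proof (induction k arbitrary: j A)
    case 0
    then show ?case by (simp add: c)
  next
    case (Suc k)
    then obtain A' where "mlin_derivative j V A A'" "mlin_Ck k (Suc j) V A'" by auto
    with Suc show ?case using c d by (auto intro!: exI[of _ "\<lambda>x vs. - A' x vs"])
  qed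
qed

text \<open>
  In the iterated derivatives of a product, each direction of differentiation falls on one of the two
  factors. A Boolean mask records the choice, one entry per direction.
\<close>
definition pick :: "bool list \<Rightarrow> 'a list \<Rightarrow> 'a list"
  where "pick bs vs = map snd (filter fst (zip bs vs))"

lemma pick_Cons [simp]: "pick (b # bs) (v # vs) = (if b then v # pick bs vs else pick bs vs)"
  by (simp add: pick_def)

lemma pick_Nil [simp]: "pick [] vs = []" "pick bs [] = []"
  by (simp_all add: pick_def)

lemma pick_append:
  "length bs = length vs \<Longrightarrow> pick (bs @ cs) (vs @ ws) = pick bs vs @ pick cs ws"
  by (simp add: pick_def)

lemma length_pick: "length bs = length vs \<Longrightarrow> length (pick bs vs) = count_list bs True"
  by (induction bs vs rule: list_induct2) auto

lemma count_list_map_Not: "count_list (map Not bs) True = count_list bs False"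
  by (induction bs) auto

lemma prod_list_norm_pick:
  "length bs = length vs \<Longrightarrow>
    prod_list (map norm vs) = prod_list (map norm (pick bs vs)) * prod_list (map norm (pick (map Not bs) vs))"
  by (induction bs vs rule: list_induct2) auto

text \<open>
  Masks make the Leibniz rule free of permutations: the new direction is the head of the list, and
  the two summands of the derivative are the products with mask \<open>True # bs\<close> (derivative of the left
  factor) and \<open>False # bs\<close> (derivative of the right factor).
\<close>
definition shuffle_product :: "bool list \<Rightarrow> ('a list \<Rightarrow> real) \<Rightarrow> ('a list \<Rightarrow> real) \<Rightarrow> 'a list \<Rightarrow> real"
  where "shuffle_product bs M N vs = M (pick bs vs) * N (pick (map Not bs) vs)"

lemma mlin_bound_shuffle_product:
  fixes M N :: "'a::real_normed_vector list \<Rightarrow> real"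
  assumes "mlin_bound (count_list bs True) C M" "mlin_bound (count_list bs False) D N" "0 \<le> C"
  shows "mlin_bound (length bs) (C * D) (shuffle_product bs M N)"
  unfolding mlin_bound_def
proof (intro allI impI)
  fix vs :: "'a list" assume l: "length vs = length bs"
  have "norm (shuffle_product bs M N vs) = norm (M (pick bs vs)) * norm (N (pick (map Not bs) vs))"
    by (simp add: shuffle_product_def abs_mult)
  also have "\<dots> \<le> (C * prod_list (map norm (pick bs vs))) * (D * prod_list (map norm (pick (map Not bs) vs)))"
    using assms l by (intro mult_mono) (auto simp: mlin_bound_def length_pick count_list_map_Not prod_list_norm_nonneg)
  also have "\<dots> = C * D * prod_list (map norm vs)"
    using l by (simp add: prod_list_norm_pick[of bs vs])
  finally show "norm (shuffle_product bs M N vs) \<le> C * D * prod_list (map norm vs)" .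
qed

lemma bounded_mlin_shuffle_product:
  fixes M N :: "'a::real_normed_vector list \<Rightarrow> real"
  assumes "bounded_mlin (count_list bs True) M" "bounded_mlin (count_list bs False) N"
  shows "bounded_mlin (length bs) (shuffle_product bs M N)"
  unfolding bounded_mlin_def
proof (intro conjI allI impI)
  from assms obtain C D where "mlin_bound (count_list bs True) C M" "mlin_bound (count_list bs False) D N"
    unfolding bounded_mlin_def by blast
  then show "\<exists>C. mlin_bound (length bs) C (shuffle_product bs M N)"
    using mlin_bound_shuffle_product[of bs "\<bar>C\<bar>" M D N] mlin_bound_nonneg by auto
next
  fix us ws :: "'a list" assume l: "length us + length ws + 1 = length bs"
  define bs1 where "bs1 = take (length us) bs"
  define bs2 where "bs2 = drop (Suc (length us)) bs"
  define b where "b = bs ! length us"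
  have bs: "bs = bs1 @ b # bs2" "length bs1 = length us" "length bs2 = length ws"
    using l by (auto simp: bs1_def bs2_def b_def id_take_nth_drop)
  show "linear (\<lambda>v. shuffle_product bs M N (us @ v # ws))"
  proof (cases b)
    case True
    have "linear (\<lambda>v. M (pick bs1 us @ v # pick bs2 ws))"
      using assms(1) True bs by (intro bounded_mlin_linear[OF assms(1)]) (simp add: length_pick)
    from linear_compose_scale_right[OF this, of "N (pick (map Not bs1) us @ pick (map Not bs2) ws)"]
    show ?thesis using True bs(2,3) unfolding bs(1)
      by (simp add: shuffle_product_def pick_append mult.commute)
  next
    case False
    have "linear (\<lambda>v. N (pick (map Not bs1) us @ v # pick (map Not bs2) ws))"
      using assms(2) False bs by (intro bounded_mlin_linear[OF assms(2)]) (simp add: length_pick count_list_map_Not)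
    from linear_compose_scale_right[OF this, of "M (pick bs1 us @ pick bs2 ws)"]
    show ?thesis using False bs(2,3) unfolding bs(1)
      by (simp add: shuffle_product_def pick_append)
  qed
qed

lemma mlin_continuous_boundE:
  assumes "mlin_continuous j V A" "x \<in> V"
  obtains C where "0 \<le> C" "mlin_bound j C (A x)" "\<forall>\<^sub>F y in at x within V. mlin_bound j (C + 1) (A y)"
proof -
  from assms obtain C where "mlin_bound j C (A x)"
    unfolding mlin_continuous_def bounded_mlin_def by blast
  then have C: "mlin_bound j \<bar>C\<bar> (A x)" by (rule mlin_bound_nonneg)
  have "\<forall>\<^sub>F y in at x within V. mlin_bound j 1 (\<lambda>vs. A y vs - A x vs)"
    using assms unfolding mlin_continuous_def by auto
  then have "\<forall>\<^sub>F y in at x within V. mlin_bound j (\<bar>C\<bar> + 1) (A y)"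
  proof eventually_elim
    case (elim y)
    from mlin_bound_add[OF C elim] show ?case by simp
  qed
  with C show ?thesis by (intro that[of "\<bar>C\<bar>"]) auto
qed

text \<open>
  As for scalar products: \<open>A y B y - A x B x = (A y - A x) B y + A x (B y - B x)\<close>, where the norm of
  \<open>B y\<close> is bounded for \<open>y\<close> near \<open>x\<close>.
\<close>
lemma mlin_continuous_shuffle_product:
  fixes A B :: "'a::real_normed_vector \<Rightarrow> 'a list \<Rightarrow> real"
  assumes A: "mlin_continuous (count_list bs True) V A" and B: "mlin_continuous (count_list bs False) V B"
  shows "mlin_continuous (length bs) V (\<lambda>x. shuffle_product bs (A x) (B x))"
  unfolding mlin_continuous_def
proof (intro conjI ballI allI impI)
  fix x assume x: "x \<in> V"
  then show "bounded_mlin (length bs) (shuffle_product bs (A x) (B x))"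
    using assms bounded_mlin_shuffle_product unfolding mlin_continuous_def by blast
  obtain a where a: "0 \<le> a" "mlin_bound (count_list bs True) a (A x)"
    using mlin_continuous_boundE[OF A x] by blast
  obtain b where b: "0 \<le> b" "\<forall>\<^sub>F y in at x within V. mlin_bound (count_list bs False) (b + 1) (B y)"
    using mlin_continuous_boundE[OF B x] by blast
  fix e :: real assume e: "e > 0"
  \<comment> \<open>chosen so that the two error bounds add up to exactly \<open>e\<close>\<close>
  define d where "d = e / (a + b + 1)"
  have d: "d > 0" using a b e by (simp add: d_def)
  have "d * (a + b + 1) = e" using a b by (simp add: d_def)
  then have de: "d * (b + 1) + a * d = e" by (simp add: algebra_simps)
  have "\<forall>\<^sub>F y in at x within V. mlin_bound (count_list bs True) d (\<lambda>vs. A y vs - A x vs)"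
       "\<forall>\<^sub>F y in at x within V. mlin_bound (count_list bs False) d (\<lambda>vs. B y vs - B x vs)"
    using A B x d unfolding mlin_continuous_def by blast+
  then show "\<forall>\<^sub>F y in at x within V. mlin_bound (length bs) e
      (\<lambda>vs. shuffle_product bs (A y) (B y) vs - shuffle_product bs (A x) (B x) vs)"
    using b(2)
  proof eventually_elim
    case (elim y)
    have "mlin_bound (length bs) (d * (b + 1)) (shuffle_product bs (\<lambda>vs. A y vs - A x vs) (B y))"
      using elim d by (intro mlin_bound_shuffle_product) auto
    moreover have "mlin_bound (length bs) (a * d) (shuffle_product bs (A x) (\<lambda>vs. B y vs - B x vs))"
      using elim a by (intro mlin_bound_shuffle_product) auto
    ultimately have "mlin_bound (length bs) e (\<lambda>vs. shuffle_product bs (\<lambda>vs. A y vs - A x vs) (B y) vs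
        + shuffle_product bs (A x) (\<lambda>vs. B y vs - B x vs) vs)"
      unfolding de[symmetric] by (rule mlin_bound_add)
    then show ?case
      by (simp add: shuffle_product_def algebra_simps)
  qed
qed

text \<open>
  With \<open>h = y - x\<close>, the error of the linear approximation splits as
  \<open>(A y - A x - A' x h) B y + A' x h (B y - B x) + A x (B y - B x - B' x h)\<close>,
  and each summand is small compared with the norm of \<open>h\<close>.
\<close>
lemma mlin_derivative_shuffle_product:
  fixes A B :: "'a::real_normed_vector \<Rightarrow> 'a list \<Rightarrow> real"
  assumes A: "mlin_continuous (count_list bs True) V A" and B: "mlin_continuous (count_list bs False) V B"
    and A': "mlin_derivative (count_list bs True) V A A'" and B': "mlin_derivative (count_list bs False) V B B'"
    and bd: "\<And>x. x \<in> V \<Longrightarrow> bounded_mlin (Suc (count_list bs True)) (A' x)"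
  shows "mlin_derivative (length bs) V (\<lambda>x. shuffle_product bs (A x) (B x))
     (\<lambda>x vs. shuffle_product (True # bs) (A' x) (B x) vs + shuffle_product (False # bs) (A x) (B' x) vs)"
  unfolding mlin_derivative_def
proof (intro ballI allI impI)
  fix x assume x: "x \<in> V"
  obtain a where a: "0 \<le> a" "mlin_bound (count_list bs True) a (A x)"
    using mlin_continuous_boundE[OF A x] by blast
  obtain b where b: "0 \<le> b" "\<forall>\<^sub>F y in at x within V. mlin_bound (count_list bs False) (b + 1) (B y)"
    using mlin_continuous_boundE[OF B x] by blast
  obtain a' where a': "0 \<le> a'" "mlin_bound (Suc (count_list bs True)) a' (A' x)"
    using bd[OF x] mlin_bound_nonneg abs_ge_zero unfolding bounded_mlin_def by meson
  fix e :: real assume e: "e > 0"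
  \<comment> \<open>chosen so that the three error bounds add up to exactly \<open>e * norm (y - x)\<close>\<close>
  define d where "d = e / (a + b + a' + 1)"
  have d: "d > 0" using a b a' e by (simp add: d_def)
  have "d * (a + b + a' + 1) = e" using a b a' by (simp add: d_def)
  then have de: "d * (b + 1) + a' * d + a * d = e" by (simp add: algebra_simps)
  have "\<forall>\<^sub>F y in at x within V. mlin_bound (count_list bs True) (d * norm (y - x)) (\<lambda>vs. A y vs - A x vs - A' x ((y - x) # vs))"
       "\<forall>\<^sub>F y in at x within V. mlin_bound (count_list bs False) (d * norm (y - x)) (\<lambda>vs. B y vs - B x vs - B' x ((y - x) # vs))"
       "\<forall>\<^sub>F y in at x within V. mlin_bound (count_list bs False) d (\<lambda>vs. B y vs - B x vs)"
    using A' B' B x d unfolding mlin_continuous_def mlin_derivative_def by blast+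
  then show "\<forall>\<^sub>F y in at x within V. mlin_bound (length bs) (e * norm (y - x))
      (\<lambda>vs. shuffle_product bs (A y) (B y) vs - shuffle_product bs (A x) (B x) vs
        - (shuffle_product (True # bs) (A' x) (B x) ((y - x) # vs) + shuffle_product (False # bs) (A x) (B' x) ((y - x) # vs)))"
    using b(2)
  proof eventually_elim
    case (elim y)
    define h where "h = y - x"
    note elim = elim[folded h_def]
    have "mlin_bound (count_list bs True) (a' * norm h) (\<lambda>vs. A' x (h # vs))"
      using a'(2)[unfolded mlin_bound_def, rule_format, of "h # _"] unfolding mlin_bound_def
      by (simp add: mult.assoc)
    then have "mlin_bound (length bs) (a' * norm h * d) (shuffle_product bs (\<lambda>vs. A' x (h # vs)) (\<lambda>vs. B y vs - B x vs))"
      using elim a' by (intro mlin_bound_shuffle_product) auto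
    moreover have "mlin_bound (length bs) (d * norm h * (b + 1))
        (shuffle_product bs (\<lambda>vs. A y vs - A x vs - A' x (h # vs)) (B y))"
      using elim d by (intro mlin_bound_shuffle_product) auto
    moreover have "mlin_bound (length bs) (a * (d * norm h))
        (shuffle_product bs (A x) (\<lambda>vs. B y vs - B x vs - B' x (h # vs)))"
      using elim a by (intro mlin_bound_shuffle_product) auto
    ultimately have "mlin_bound (length bs) (d * norm h * (b + 1) + a' * norm h * d + a * (d * norm h))
       (\<lambda>vs. shuffle_product bs (\<lambda>vs. A y vs - A x vs - A' x (h # vs)) (B y) vs +
          shuffle_product bs (\<lambda>vs. A' x (h # vs)) (\<lambda>vs. B y vs - B x vs) vs +
          shuffle_product bs (A x) (\<lambda>vs. B y vs - B x vs - B' x (h # vs)) vs)"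
      by (intro mlin_bound_add)
    moreover have "d * norm h * (b + 1) + a' * norm h * d + a * (d * norm h) = e * norm h"
      unfolding de[symmetric] by (simp add: algebra_simps)
    ultimately show ?case
      unfolding h_def[symmetric] by (simp add: shuffle_product_def algebra_simps)
  qed
qed

lemma mlin_Ck_shuffle_product:
  fixes A B :: "'a::real_normed_vector \<Rightarrow> 'a list \<Rightarrow> real"
  assumes "mlin_Ck k (count_list bs True) V A" "mlin_Ck k (count_list bs False) V B"
  shows "mlin_Ck k (length bs) V (\<lambda>x. shuffle_product bs (A x) (B x))"
  using assms
proof (induction k arbitrary: bs A B)
  case 0
  then show ?case by (simp add: mlin_continuous_shuffle_product)
next
  case (Suc k)
  then obtain A' B' where
    A: "mlin_continuous (count_list bs True) V A" "mlin_derivative (count_list bs True) V A A'"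
       "mlin_Ck k (Suc (count_list bs True)) V A'" and
    B: "mlin_continuous (count_list bs False) V B" "mlin_derivative (count_list bs False) V B B'"
       "mlin_Ck k (Suc (count_list bs False)) V B'" by auto
  have 1: "mlin_Ck k (length (True # bs)) V (\<lambda>x. shuffle_product (True # bs) (A' x) (B x))"
    by (rule Suc.IH) (use A(3) mlin_Ck_SucD[OF Suc.prems(2)] in simp_all)
  have 2: "mlin_Ck k (length (False # bs)) V (\<lambda>x. shuffle_product (False # bs) (A x) (B' x))"
    by (rule Suc.IH) (use B(3) mlin_Ck_SucD[OF Suc.prems(1)] in simp_all)
  have "\<And>x. x \<in> V \<Longrightarrow> bounded_mlin (Suc (count_list bs True)) (A' x)"
    using mlin_Ck_continuous[OF A(3)] unfolding mlin_continuous_def by blast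
  from mlin_derivative_shuffle_product[OF A(1) B(1) A(2) B(2) this]
  have "mlin_derivative (length bs) V (\<lambda>x. shuffle_product bs (A x) (B x))
     (\<lambda>x vs. shuffle_product (True # bs) (A' x) (B x) vs + shuffle_product (False # bs) (A x) (B' x) vs)" .
  moreover have "mlin_Ck k (Suc (length bs)) V
     (\<lambda>x vs. shuffle_product (True # bs) (A' x) (B x) vs + shuffle_product (False # bs) (A x) (B' x) vs)"
    using mlin_Ck_add[of k "Suc (length bs)" V] 1 2 by simp
  ultimately show ?case
    using mlin_continuous_shuffle_product[OF A(1) B(1)] by auto
qed

text \<open>
  Evaluation at fixed directions turns the operator-norm derivative into a library derivative, which
  makes the chain rule and the uniqueness of derivatives available.
\<close>
lemma mlin_derivative_imp_has_derivative:
  assumes "mlin_derivative j V A A'" "x \<in> V" "bounded_mlin (Suc j) (A' x)" "length vs = j"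
  shows "((\<lambda>y. A y vs) has_derivative (\<lambda>h. A' x (h # vs))) (at x within V)"
  unfolding has_derivative_within_alt2
proof (intro conjI allI impI)
  obtain C where C: "mlin_bound (Suc j) C (A' x)"
    using assms(3) unfolding bounded_mlin_def by blast
  have lin: "linear (\<lambda>h. A' x (h # vs))"
    using bounded_mlin_linear[OF assms(3), of "[]" vs] assms(4) by simp
  show "bounded_linear (\<lambda>h. A' x (h # vs))"
  proof (rule bounded_linear_intro)
    fix h
    have "norm (A' x (h # vs)) \<le> C * prod_list (map norm (h # vs))"
      using C assms(4) unfolding mlin_bound_def by (metis length_Cons)
    then show "norm (A' x (h # vs)) \<le> norm h * (C * prod_list (map norm vs))"
      by (simp add: mult_ac)
  qed (use linear_add[OF lin] linear_scale[OF lin] in auto)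
next
  fix e :: real assume e: "e > 0"
  define p where "p = prod_list (map norm vs)"
  have p: "p \<ge> 0" by (simp add: p_def prod_list_norm_nonneg)
  have "0 < e / (p + 1)" using e p by simp
  from assms(1)[unfolded mlin_derivative_def, rule_format, OF assms(2) this]
  have "\<forall>\<^sub>F y in at x within V. mlin_bound j (e / (p + 1) * norm (y - x)) (\<lambda>vs. A y vs - A x vs - A' x ((y - x) # vs))" .
  then show "\<forall>\<^sub>F y in at x within V. norm (A y vs - A x vs - A' x ((y - x) # vs)) \<le> e * norm (y - x)"
  proof eventually_elim
    case (elim y)
    then have "norm (A y vs - A x vs - A' x ((y - x) # vs)) \<le> e / (p + 1) * norm (y - x) * p"
      using assms(4) unfolding mlin_bound_def p_def by blast
    also have "\<dots> = (e * norm (y - x)) * (p / (p + 1))" by simp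
    also have "\<dots> \<le> (e * norm (y - x)) * 1"
      using p e by (intro mult_left_mono) auto
    finally show ?case by simp
  qed
qed

text \<open>
  The derivative of \<open>F\<^sub>n \<circ> u\<close> is the product of \<open>F\<^sub>n\<^sub>+\<^sub>1 \<circ> u\<close> and the derivative of \<open>u\<close>. Both factors are
  \<open>C\<^sup>k\<close> if \<open>u\<close> is \<open>C\<^sup>k\<^sup>+\<^sup>1\<close>, the first by induction, provided that all the \<open>F\<^sub>n\<close> are treated at once.
\<close>
lemma mlin_Ck_compose:
  fixes F :: "nat \<Rightarrow> real \<Rightarrow> real" and u :: "'a::real_normed_vector \<Rightarrow> real"
  assumes F: "\<And>n t. (F n has_real_derivative F (Suc n) t) (at t)"
    and u: "mlin_Ck k 0 V (\<lambda>x _. u x)"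
  shows "mlin_Ck k 0 V (\<lambda>x _. F n (u x))"
proof -
  have cont: "mlin_Ck 0 0 V (\<lambda>x _. F n (u x))" if "mlin_Ck 0 0 V (\<lambda>x _. u x)" for n
    using that continuous_on_compose2[OF DERIV_continuous_on[of UNIV "F n"], OF F]
    unfolding Ck_on_iff_mlin_Ck[symmetric] Ck_on_0 by auto
  show ?thesis
    using u
  proof (induction k arbitrary: n)
    case 0
    then show ?case using cont by simp
  next
    case (Suc k)
    then obtain u' where u': "mlin_derivative 0 V (\<lambda>x _. u x) u'" "mlin_Ck k (Suc 0) V u'" by auto
    note u_k = mlin_Ck_SucD[OF Suc.prems]
    \<comment> \<open>the mask \<open>[False]\<close> sends the only direction to the right factor\<close>
    define G where "G = (\<lambda>x. shuffle_product [False] (\<lambda>_. F (Suc n) (u x)) (u' x))"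
    have "mlin_Ck k (length [False]) V G"
      unfolding G_def by (rule mlin_Ck_shuffle_product) (use u'(2) Suc.IH[OF u_k] in simp_all)
    moreover have "mlin_derivative 0 V (\<lambda>x _. F n (u x)) G"
      unfolding mlin_derivative_def
    proof (intro ballI allI impI)
      fix x and e :: real assume x: "x \<in> V" and e: "e > 0"
      have "(u has_derivative (\<lambda>h. u' x [h])) (at x within V)"
        using mlin_derivative_imp_has_derivative[OF u'(1) x, of "[]"] mlin_Ck_continuous[OF u'(2)] x
        unfolding mlin_continuous_def by auto
      from has_derivative_compose[OF this, of "F n" "\<lambda>h. F (Suc n) (u x) * h"] F[of n "u x"]
      have "((\<lambda>x. F n (u x)) has_derivative (\<lambda>h. F (Suc n) (u x) * u' x [h])) (at x within V)"
        unfolding has_field_derivative_def by simp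
      then have "\<forall>\<^sub>F y in at x within V. norm (F n (u y) - F n (u x) - F (Suc n) (u x) * u' x [y - x]) \<le> e * norm (y - x)"
        unfolding has_derivative_within_alt2 using e by blast
      then show "\<forall>\<^sub>F y in at x within V. mlin_bound 0 (e * norm (y - x)) (\<lambda>vs. F n (u y) - F n (u x) - G x ((y - x) # vs))"
        by (simp add: mlin_bound_def G_def shuffle_product_def)
    qed
    moreover have "mlin_continuous 0 V (\<lambda>x _. F n (u x))"
      using cont mlin_Ck_mono[OF Suc.prems, of 0] by simp
    ultimately show ?case by auto
  qed
qed

text \<open>
  Differentiability is a local property, but the derivatives provided by the different open sets are
  only determined up to their values on lists of the wrong length. On lists of the right length they
  agree wherever two of the sets overlap, since derivatives are unique; hence choosing at each point
  one of the sets that contain it yields a derivative on the union.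
\<close>
lemma mlin_Ck_Union:
  assumes "\<And>W. W \<in> \<W> \<Longrightarrow> open W" "\<And>W. W \<in> \<W> \<Longrightarrow> mlin_Ck k j W A"
  shows "mlin_Ck k j (\<Union>\<W>) A"
proof -
  have at: "at x within \<Union>\<W> = at x within W" if "W \<in> \<W>" "x \<in> W" for x W
    using that assms(1) at_within_open[of x W] at_within_open[of x "\<Union>\<W>"] by auto
  have c: "mlin_continuous j (\<Union>\<W>) A" if "\<And>W. W \<in> \<W> \<Longrightarrow> mlin_continuous j W A" for j A
    using that at unfolding mlin_continuous_def by simp
  have d: "mlin_derivative j (\<Union>\<W>) A A'" if "\<And>W. W \<in> \<W> \<Longrightarrow> mlin_derivative j W A A'" for j A A'
    using that at unfolding mlin_derivative_def by simp
  show ?thesis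
    using assms(2)
  proof (induction k arbitrary: j A)
    case 0
    then show ?case by (simp add: c)
  next
    case (Suc k)
    then have "\<forall>W\<in>\<W>. \<exists>A'. mlin_derivative j W A A' \<and> mlin_Ck k (Suc j) W A'" by auto
    then obtain A' where A': "\<And>W. W \<in> \<W> \<Longrightarrow> mlin_derivative j W A (A' W)"
       "\<And>W. W \<in> \<W> \<Longrightarrow> mlin_Ck k (Suc j) W (A' W)" by metis
    have der: "((\<lambda>y. A y vs) has_derivative (\<lambda>h. A' W x (h # vs))) (at x)"
      if "W \<in> \<W>" "x \<in> W" "length vs = j" for W x vs
      using mlin_derivative_imp_has_derivative[OF A'(1)[OF that(1)] that(2) _ that(3)]
        mlin_Ck_continuous[OF A'(2)[OF that(1)]] that at_within_open[OF that(2) assms(1)]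
      unfolding mlin_continuous_def by simp
    define pickW where "pickW x = (SOME W. W \<in> \<W> \<and> x \<in> W)" for x
    have pickW: "pickW x \<in> \<W>" "x \<in> pickW x" if "W \<in> \<W>" "x \<in> W" for x W
      using someI[of "\<lambda>W. W \<in> \<W> \<and> x \<in> W" W] that unfolding pickW_def by auto
    define B where "B x = A' (pickW x) x" for x
    have B: "A' W x vs = B x vs" if "W \<in> \<W>" "x \<in> W" "length vs = Suc j" for W x vs
    proof -
      from that(3) obtain v ws where vs: "vs = v # ws" "length ws = j"
        by (cases vs) auto
      show ?thesis
        using has_derivative_unique[OF der[OF that(1,2) vs(2)] der[OF pickW[OF that(1,2)] vs(2)]]
        unfolding vs(1) B_def by meson
    qed
    have "mlin_derivative j (\<Union>\<W>) A B"
      by (rule d, rule mlin_derivative_cong[OF _ _ A'(1)]) (use B in auto)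
    moreover have "mlin_Ck k (Suc j) (\<Union>\<W>) B"
      by (rule Suc.IH, rule mlin_Ck_cong[OF _ A'(2)]) (use B in auto)
    moreover have "mlin_continuous j (\<Union>\<W>) A"
      using Suc.prems by (intro c) auto
    ultimately show ?case by auto
  qed
qed

section \<open>A smooth maximum\<close>

text \<open>
  For \<open>c > 0\<close>, the functions in this family are flat at 0, the family is closed under differentiation,
  and it contains all derivatives of the ramp below.
\<close>
definition flat_exp :: "real \<Rightarrow> real poly \<Rightarrow> real \<Rightarrow> real"
  where "flat_exp c p s = (if 0 < s then poly p (1 / s) * exp (- c / s) else 0)"

text \<open>
  For \<open>c > 0\<close>, a smooth convex substitute for \<open>max 0 s\<close>. It vanishes exactly for \<open>s \<le> 0\<close>, has slope between 0 and
  1, and lies between \<open>s - c\<close> and \<open>max 0 s\<close>.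
\<close>
definition soft_ramp :: "real \<Rightarrow> real \<Rightarrow> real"
  where "soft_ramp c s = (if 0 < s then s * exp (- c / s) else 0)"

text \<open>
  From the right, the substitution \<open>u = 1/s\<close> reduces this to the decay of \<open>u\<^sup>i exp(-c u)\<close> at infinity.
\<close>
lemma flat_exp_tendsto_0:
  assumes "0 < c"
  shows "(flat_exp c p \<longlongrightarrow> 0) (at 0)"
proof -
  have mono: "((\<lambda>u. u ^ i * exp (- c * u)) \<longlongrightarrow> 0) at_top" for i
  proof -
    have "filterlim (\<lambda>u. c * u) at_top at_top"
      using assms by (intro filterlim_tendsto_pos_mult_at_top[OF tendsto_const]) (auto intro: filterlim_ident)
    from filterlim_compose[OF tendsto_power_div_exp_0 this]
    have "((\<lambda>u. (c * u) ^ i / exp (c * u)) \<longlongrightarrow> 0) at_top" .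
    from tendsto_mult_left[OF this, of "1 / c ^ i"]
    have "((\<lambda>u. 1 / c ^ i * ((c * u) ^ i / exp (c * u))) \<longlongrightarrow> 0) at_top" by simp
    moreover have "1 / c ^ i * ((c * u) ^ i / exp (c * u)) = u ^ i * exp (- c * u)" for u
      using assms by (simp add: power_mult_distrib exp_minus field_simps)
    ultimately show ?thesis by simp
  qed
  have "((\<lambda>u. \<Sum>i\<le>degree p. coeff p i * (u ^ i * exp (- c * u))) \<longlongrightarrow> (\<Sum>i\<le>degree p. coeff p i * 0)) at_top"
    by (intro tendsto_sum tendsto_mult_left mono)
  then have "((\<lambda>u. poly p u * exp (- c * u)) \<longlongrightarrow> 0) at_top"
    by (simp add: poly_altdef sum_distrib_right mult.assoc)
  from filterlim_compose[OF this filterlim_inverse_at_top_right]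
  have R: "((\<lambda>s. poly p (1 / s) * exp (- c / s)) \<longlongrightarrow> 0) (at_right 0)"
    by (simp add: divide_inverse)
  have "(flat_exp c p \<longlongrightarrow> 0) (at_right 0)"
    by (rule Lim_transform_eventually[OF R])
       (auto simp: flat_exp_def eventually_at_filter)
  moreover have "(flat_exp c p \<longlongrightarrow> 0) (at_left 0)"
    by (rule Lim_transform_eventually[OF tendsto_const])
       (auto simp: flat_exp_def eventually_at_filter)
  ultimately show ?thesis by (simp add: filterlim_split_at)
qed

lemma has_real_derivative_glue_0:
  fixes f g :: "real \<Rightarrow> real"
  assumes "f 0 = 0" "\<And>s. s < 0 \<Longrightarrow> f s = 0" "\<And>s. s \<le> 0 \<Longrightarrow> g s = 0"
    and "\<And>s. 0 < s \<Longrightarrow> f s = h s"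
    and "\<And>s. 0 < s \<Longrightarrow> (h has_real_derivative g s) (at s)"
    and "((\<lambda>s. f s / s) \<longlongrightarrow> 0) (at 0)"
  shows "(f has_real_derivative g s) (at s)"
proof -
  consider "s < 0" | "s = 0" | "0 < s" by linarith
  then show ?thesis
  proof cases
    case 1
    have "((\<lambda>_. 0) has_real_derivative g s) (at s)" using 1 assms(3) by simp
    then show ?thesis
      by (rule DERIV_cong_ev[THEN iffD1, rotated -1])
         (use 1 assms(2) eventually_nhds_in_open[of "{..<0}" s] in \<open>auto elim!: eventually_mono\<close>)
  next
    case 2
    then show ?thesis using assms by (simp add: DERIV_def)
  next
    case 3
    from assms(5)[OF this] show ?thesis
      by (rule DERIV_cong_ev[THEN iffD1, rotated -1])
         (use 3 assms(4) eventually_nhds_in_open[of "{0<..}" s] in \<open>auto elim!: eventually_mono\<close>)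
  qed
qed

text \<open>
  In the variable \<open>u = 1/s\<close>, with \<open>du/ds = - u\<^sup>2\<close>, the derivative of \<open>p(u) exp(-c u)\<close> is
  \<open>u\<^sup>2 (c p(u) - p'(u)) exp(-c u)\<close>. At \<open>s = 0\<close> the difference quotient is again a flat function, for the
  polynomial \<open>u p(u)\<close>, so it tends to 0.
\<close>
lemma DERIV_flat_exp:
  assumes "0 < c"
  shows "(flat_exp c p has_real_derivative flat_exp c ([:0, 0, 1:] * (smult c p - pderiv p)) s) (at s)"
proof (rule has_real_derivative_glue_0[where h = "\<lambda>s. poly p (1 / s) * exp (- c / s)"])
  show "((\<lambda>s. poly p (1 / s) * exp (- c / s)) has_real_derivative
      flat_exp c ([:0, 0, 1:] * (smult c p - pderiv p)) s) (at s)" if "0 < s" for s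
    using that by (auto simp: flat_exp_def intro!: derivative_eq_intros DERIV_chain2[OF poly_DERIV])
      (simp add: field_simps power2_eq_square)
  have "(\<lambda>s. flat_exp c p s / s) = flat_exp c ([:0, 1:] * p)"
    by (auto simp: flat_exp_def)
  then show "((\<lambda>s. flat_exp c p s / s) \<longlongrightarrow> 0) (at 0)"
    using flat_exp_tendsto_0[OF assms] by simp
qed (auto simp: flat_exp_def)

lemma DERIV_soft_ramp:
  assumes "0 < c"
  shows "(soft_ramp c has_real_derivative flat_exp c [:1, c:] s) (at s)"
proof (rule has_real_derivative_glue_0[where h = "\<lambda>s. s * exp (- c / s)"])
  show "((\<lambda>s. s * exp (- c / s)) has_real_derivative flat_exp c [:1, c:] s) (at s)" if "0 < s" for s
    using that by (auto simp: flat_exp_def intro!: derivative_eq_intros)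
      (simp add: field_simps power2_eq_square)
  have "(\<lambda>s. soft_ramp c s / s) = flat_exp c 1"
    by (auto simp: flat_exp_def soft_ramp_def)
  then show "((\<lambda>s. soft_ramp c s / s) \<longlongrightarrow> 0) (at 0)"
    using flat_exp_tendsto_0[OF assms] by simp
qed (auto simp: flat_exp_def soft_ramp_def)

text \<open>
  The ramp has a factor \<open>s\<close> in front of the exponential, but its derivative \<open>(1 + c/s) exp(-c/s)\<close> is already one of
  the flat functions.
\<close>
lemma soft_ramp_smooth:
  assumes "0 < c"
  obtains F where "F 0 = soft_ramp c" "\<And>n t. (F n has_real_derivative F (Suc n) t) (at t)"
proof -
  define T where "T p = [:0, 0, 1:] * (smult c p - pderiv p)" for p :: "real poly"
  define F where "F n = (case n of 0 \<Rightarrow> soft_ramp c | Suc i \<Rightarrow> flat_exp c ((T ^^ i) [:1, c:]))" for n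
  have "(F n has_real_derivative F (Suc n) t) (at t)" for n t
    using DERIV_soft_ramp[OF assms] DERIV_flat_exp[OF assms]
    by (cases n) (auto simp: F_def T_def)
  moreover have "F 0 = soft_ramp c" by (simp add: F_def)
  ultimately show ?thesis using that by blast
qed

text \<open>
  The upper bound is \<open>1 + u \<le> exp u\<close> at \<open>u = c/s\<close>.
\<close>
lemma soft_ramp_slope_bounds:
  assumes "0 < c"
  shows "0 \<le> flat_exp c [:1, c:] s" "flat_exp c [:1, c:] s \<le> 1"
proof -
  show "0 \<le> flat_exp c [:1, c:] s" using assms by (simp add: flat_exp_def)
  have "(1 + c / s) * exp (- c / s) \<le> 1" if "0 < s"
    using exp_ge_add_one_self[of "c / s"] by (simp add: exp_minus field_simps)
  then show "flat_exp c [:1, c:] s \<le> 1" by (simp add: flat_exp_def)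
qed

lemma soft_ramp_increment:
  assumes "0 < c" "a \<le> b"
  shows "soft_ramp c a \<le> soft_ramp c b" "soft_ramp c b - soft_ramp c a \<le> b - a"
proof -
  show "soft_ramp c a \<le> soft_ramp c b"
    using DERIV_nonneg_imp_nondecreasing[OF assms(2)] DERIV_soft_ramp[OF assms(1)]
      soft_ramp_slope_bounds(1)[OF assms(1)] by blast
  have "a - soft_ramp c a \<le> b - soft_ramp c b"
  proof (rule DERIV_nonneg_imp_nondecreasing[OF assms(2)])
    show "\<exists>y. ((\<lambda>s. s - soft_ramp c s) has_real_derivative y) (at x) \<and> 0 \<le> y" for x
      using soft_ramp_slope_bounds(2)[OF assms(1), of x]
      by (auto intro!: exI derivative_intros DERIV_soft_ramp[OF assms(1)])
  qed
  then show "soft_ramp c b - soft_ramp c a \<le> b - a" by simp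
qed

text \<open>
  For \<open>s > 0\<close> the second derivative is \<open>c\<^sup>2 exp(-c/s) / s\<^sup>3\<close>.
\<close>
lemma soft_ramp_convex:
  assumes "0 < c"
  shows "convex_on UNIV (soft_ramp c)"
proof (rule convex_on_realI)
  fix x y :: real assume "x \<le> y"
  have "0 \<le> flat_exp c ([:0, 0, 1:] * (smult c [:1, c:] - pderiv [:1, c:])) s" for s
    using assms by (simp add: flat_exp_def pderiv_pCons)
  then show "flat_exp c [:1, c:] x \<le> flat_exp c [:1, c:] y"
    using DERIV_nonneg_imp_nondecreasing[OF \<open>x \<le> y\<close>] DERIV_flat_exp[OF assms] by blast
qed (use DERIV_soft_ramp[OF assms] in auto)

lemma soft_ramp_le:
  assumes "0 < c" shows "soft_ramp c s \<le> max 0 s"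
proof -
  have "exp (- c / s) \<le> 1" if "0 < s"
    using assms that by simp
  then show ?thesis by (auto simp: soft_ramp_def mult_le_cancel_left1)
qed

lemma soft_ramp_ge:
  assumes "0 < c" shows "s - c \<le> soft_ramp c s"
proof (cases "0 < s")
  case True
  have "s - c = s * (1 + - c / s)" using True by (simp add: field_simps)
  also have "\<dots> \<le> s * exp (- c / s)" using True by (intro mult_left_mono exp_ge_add_one_self) auto
  finally show ?thesis using True by (simp add: soft_ramp_def)
qed (use assms in \<open>auto simp: soft_ramp_def\<close>)

text \<open>
  A smooth version of \<open>max x y = x + max 0 (y - x)\<close>. The ramp is shifted by \<open>c\<close>, which keeps the value
  above \<open>y\<close> and lets it be exactly \<open>x\<close> once \<open>x\<close> exceeds \<open>y\<close> by \<open>c\<close>; this last property makes gluing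
  possible.
\<close>
definition soft_max :: "real \<Rightarrow> real \<Rightarrow> real \<Rightarrow> real"
  where "soft_max c x y = x + soft_ramp c (y - x + c)"

lemma soft_max_ge: "0 < c \<Longrightarrow> y \<le> soft_max c x y"
  using soft_ramp_ge[of c "y - x + c"] by (simp add: soft_max_def)

lemma soft_max_le: "0 < c \<Longrightarrow> soft_max c x y \<le> max x (y + c)"
  using soft_ramp_le[of c "y - x + c"] by (simp add: soft_max_def max_def split: if_splits)

lemma soft_max_eq_left: "y + c \<le> x \<Longrightarrow> soft_max c x y = x"
  by (simp add: soft_max_def soft_ramp_def)

text \<open>
  Monotonicity in \<open>x\<close> holds because the ramp has slope at most 1.
\<close>
lemma soft_max_mono:
  assumes "0 < c" "x \<le> x'" "y \<le> y'"
  shows "soft_max c x y \<le> soft_max c x' y'"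
  using soft_ramp_increment(2)[of c "y - x' + c" "y - x + c"]
    soft_ramp_increment(1)[of c "y - x' + c" "y' - x' + c"] assms
  by (simp add: soft_max_def)

text \<open>
  The soft maximum is jointly convex, being a linear function plus the convex ramp of an affine
  function, and it is monotone in both arguments, so it may be applied to convex functions.
\<close>
lemma convex_on_soft_max:
  assumes "0 < c" "convex_on S u" "convex_on S w"
  shows "convex_on S (\<lambda>x. soft_max c (u x) (w x))"
  unfolding convex_on_def
proof (intro conjI ballI allI impI)
  show "convex S" using assms(2) by (simp add: convex_on_def)
  fix x y and s t :: real assume *: "x \<in> S" "y \<in> S" "0 \<le> s" "0 \<le> t" "s + t = 1"
  have "soft_max c (u (s *\<^sub>R x + t *\<^sub>R y)) (w (s *\<^sub>R x + t *\<^sub>R y))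
      \<le> soft_max c (s * u x + t * u y) (s * w x + t * w y)"
    using assms * by (intro soft_max_mono) (auto simp: convex_on_def)
  also have "\<dots> \<le> s * soft_max c (u x) (w x) + t * soft_max c (u y) (w y)"
  proof -
    have "s * w x + t * w y - (s * u x + t * u y) + c = s * (w x - u x + c) + t * (w y - u y + c)"
    proof -
      have "c = s * c + t * c" using *(5) by (simp flip: distrib_right)
      then show ?thesis by (simp add: algebra_simps)
    qed
    moreover have "soft_ramp c (s * (w x - u x + c) + t * (w y - u y + c))
       \<le> s * soft_ramp c (w x - u x + c) + t * soft_ramp c (w y - u y + c)"
      using soft_ramp_convex[OF assms(1)] * by (auto simp: convex_on_def)
    ultimately have "soft_ramp c (s * w x + t * w y - (s * u x + t * u y) + c)
       \<le> s * soft_ramp c (w x - u x + c) + t * soft_ramp c (w y - u y + c)" by simp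
    then show ?thesis by (simp add: soft_max_def distrib_left)
  qed
  finally show "soft_max c (u (s *\<^sub>R x + t *\<^sub>R y)) (w (s *\<^sub>R x + t *\<^sub>R y))
    \<le> s * soft_max c (u x) (w x) + t * soft_max c (u y) (w y)" .
qed

section \<open>Lipschitz envelopes of convex functions\<close>

text \<open>
  The points at which \<open>f\<close> lies above a downward cone of slope \<open>L\<close>. For convex and continuous \<open>f\<close> on
  an open set, these are the points with a subgradient of norm at most \<open>L\<close>.
\<close>
definition slope_region :: "('a::real_normed_vector \<Rightarrow> real) \<Rightarrow> 'a set \<Rightarrow> real \<Rightarrow> 'a set"
  where "slope_region f U L = {x \<in> U. \<forall>y\<in>U. f x - L * norm (y - x) \<le> f y}"

text \<open>
  The infimal convolution of \<open>f\<close> with the cone of slope \<open>L\<close>: the largest \<open>L\<close>-Lipschitz function on the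
  whole space that lies below \<open>f\<close> on \<open>U\<close>, if there is one.
\<close>
definition lipschitz_envelope :: "('a::real_normed_vector \<Rightarrow> real) \<Rightarrow> 'a set \<Rightarrow> real \<Rightarrow> 'a \<Rightarrow> real"
  where "lipschitz_envelope f U L z = (INF y\<in>U. f y + L * norm (z - y))"

lemma slope_region_mono: "K \<le> L \<Longrightarrow> slope_region f U K \<subseteq> slope_region f U L"
  unfolding slope_region_def
  by (smt (verit) mem_Collect_eq mult_right_mono norm_ge_zero subsetI)

text \<open>
  For \<open>x\<close> in the ball and \<open>y\<close> in \<open>U\<close>, move from \<open>x\<close> by the distance \<open>r\<close> away from \<open>y\<close>, to a point \<open>z\<close>. Then
  \<open>x\<close> lies on the segment from \<open>z\<close> to \<open>y\<close>, so a steep descent of \<open>f\<close> from \<open>x\<close> to \<open>y\<close> would force a steep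
  ascent from \<open>x\<close> to \<open>z\<close>. But both \<open>x\<close> and \<open>z\<close> lie in the ball of radius \<open>2 r\<close>, on which \<open>f\<close> varies by at
  most 2.
\<close>
lemma ball_subset_slope_region:
  assumes f: "convex_on U f" and U: "ball x0 (2 * r) \<subseteq> U" and r: "0 < r"
    and osc: "\<And>x. x \<in> ball x0 (2 * r) \<Longrightarrow> \<bar>f x - f x0\<bar> \<le> 1"
    and L: "2 / r \<le> L"
  shows "ball x0 r \<subseteq> slope_region f U L"
proof
  fix x assume x: "x \<in> ball x0 r"
  then have x2: "x \<in> ball x0 (2 * r)" using r by auto
  have "f x - L * norm (y - x) \<le> f y" if y: "y \<in> U" for y
  proof (cases "y = x")
    case False
    define d where "d = norm (y - x)"
    have d: "d > 0" using False by (simp add: d_def)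
    define z where "z = x - (r / d) *\<^sub>R (y - x)"
    have "dist z x = r" using d r by (simp add: z_def dist_norm d_def)
    then have z: "z \<in> ball x0 (2 * r)"
      using x dist_triangle[of x0 z x] by (simp add: dist_commute)
    have weights: "d / (r + d) + r / (r + d) = 1"
      using d r by (simp add: add.commute flip: add_divide_distrib)
    have xz: "x = (d / (r + d)) *\<^sub>R z + (r / (r + d)) *\<^sub>R y"
    proof -
      have "(d / (r + d)) *\<^sub>R z + (r / (r + d)) *\<^sub>R y = (d / (r + d) + r / (r + d)) *\<^sub>R x"
        using d r by (simp add: z_def algebra_simps)
      then show ?thesis by (simp add: weights)
    qed
    have "f x \<le> d / (r + d) * f z + r / (r + d) * f y"
    proof -
      have conv: "f (s *\<^sub>R p + t *\<^sub>R q) \<le> s * f p + t * f q"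
        if "p \<in> U" "q \<in> U" "0 \<le> s" "0 \<le> t" "s + t = 1" for p q s t
        using f that unfolding convex_on_def by blast
      show ?thesis
        by (subst xz, rule conv) (use z U y d r weights in auto)
    qed
    then have "(r + d) * f x \<le> (r + d) * (d / (r + d) * f z + r / (r + d) * f y)"
      using d r by (intro mult_left_mono) auto
    also have "\<dots> = d * f z + r * f y" using d r by (simp add: distrib_left)
    finally have "r * f x - d * (f z - f x) \<le> r * f y" by (simp add: algebra_simps)
    moreover have "d * (f z - f x) \<le> d * 2"
      using osc[OF z] osc[OF x2] d by (intro mult_left_mono) auto
    ultimately have "r * f x - 2 * d \<le> r * f y" by simp
    then have "f x - 2 / r * d \<le> f y" using r by (simp add: field_simps)
    moreover have "2 / r * d \<le> L * d" using L d by (intro mult_right_mono) auto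
    ultimately show ?thesis by (simp add: d_def)
  qed simp
  with x2 U show "x \<in> slope_region f U L" by (auto simp: slope_region_def)
qed

text \<open>
  This is where continuity of \<open>f\<close> enters: it bounds the oscillation near each point. The radius is not
  uniform in \<open>x\<close>, and \<open>f\<close> may be unbounded on bounded sets; the slope \<open>L\<close> depends on \<open>x\<close> accordingly.
\<close>
lemma interior_slope_region_cover:
  assumes "open U" "convex_on U f" "continuous_on U f" "x \<in> U"
  obtains L where "\<And>M. L \<le> M \<Longrightarrow> x \<in> interior (slope_region f U M)"
proof -
  obtain r1 where r1: "r1 > 0" "ball x r1 \<subseteq> U" using assms openE by blast
  obtain r2 where r2: "r2 > 0" "\<And>y. y \<in> U \<Longrightarrow> dist y x < r2 \<Longrightarrow> dist (f y) (f x) < 1"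
    using assms(3,4) unfolding continuous_on_iff by (metis zero_less_one)
  define r where "r = min r1 r2 / 2"
  have r: "r > 0" "ball x (2 * r) \<subseteq> U" using r1 r2 by (auto simp: r_def)
  have "\<bar>f y - f x\<bar> \<le> 1" if "y \<in> ball x (2 * r)" for y
    using r2(2)[of y] r that by (auto simp: r_def dist_commute dist_real_def)
  from ball_subset_slope_region[OF assms(2) r(2,1) this]
  have "x \<in> interior (slope_region f U M)" if "2 / r \<le> M" for M
    using that r(1) by (meson centre_in_ball interior_maximal open_ball subsetD)
  then show ?thesis using that by blast
qed

text \<open>
  A point of the slope region bounds \<open>f\<close> below by a cone, so the infimum in the envelope is finite.
\<close>
context
  fixes f :: "'a::real_normed_vector \<Rightarrow> real" and U L
  assumes nonempty: "slope_region f U L \<noteq> {}" and L: "0 \<le> L"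
begin

lemma lipschitz_envelope_bdd_below: "bdd_below ((\<lambda>y. f y + L * norm (z - y)) ` U)"
proof -
  obtain x where x: "x \<in> slope_region f U L" using nonempty by blast
  have "f x - L * norm (z - x) \<le> f y + L * norm (z - y)" if "y \<in> U" for y
  proof -
    have "f x - L * norm (y - x) \<le> f y" using x that by (simp add: slope_region_def)
    moreover have "L * norm (y - x) \<le> L * (norm (z - y) + norm (z - x))"
      using L norm_triangle_ineq4[of "z - x" "z - y"] by (intro mult_left_mono) auto
    ultimately show ?thesis by (simp add: distrib_left)
  qed
  then show ?thesis by (rule bdd_belowI2)
qed

lemma lipschitz_envelope_le: "y \<in> U \<Longrightarrow> lipschitz_envelope f U L z \<le> f y + L * norm (z - y)"
  unfolding lipschitz_envelope_def by (rule cINF_lower[OF lipschitz_envelope_bdd_below])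

lemma lipschitz_envelope_le_self: "x \<in> U \<Longrightarrow> lipschitz_envelope f U L x \<le> f x"
  using lipschitz_envelope_le[of x x] by simp

lemma lipschitz_envelope_eq:
  assumes "x \<in> slope_region f U L"
  shows "lipschitz_envelope f U L x = f x"
proof (rule antisym)
  show "f x \<le> lipschitz_envelope f U L x"
    unfolding lipschitz_envelope_def
    using assms by (intro cINF_greatest) (auto simp: slope_region_def norm_minus_commute)
qed (use assms lipschitz_envelope_le_self in \<open>auto simp: slope_region_def\<close>)

lemma lipschitz_envelope_approx:
  assumes "0 < e"
  obtains y where "y \<in> U" "f y + L * norm (z - y) < lipschitz_envelope f U L z + e"
proof -
  have "U \<noteq> {}" using nonempty by (auto simp: slope_region_def)
  then show ?thesis
    using that assms cINF_less_iff[OF _ lipschitz_envelope_bdd_below, of z "lipschitz_envelope f U L z + e"]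
    unfolding lipschitz_envelope_def by auto
qed

lemma lipschitz_on_envelope: "lipschitz_on L UNIV (lipschitz_envelope f U L)"
proof (rule lipschitz_onI)
  have *: "lipschitz_envelope f U L x - lipschitz_envelope f U L y \<le> L * dist x y" for x y
  proof (rule field_le_epsilon)
    fix e :: real assume "0 < e"
    then obtain w where w: "w \<in> U" "f w + L * norm (y - w) < lipschitz_envelope f U L y + e"
      by (rule lipschitz_envelope_approx)
    have "lipschitz_envelope f U L x \<le> f w + L * norm (x - w)" by (rule lipschitz_envelope_le[OF w(1)])
    moreover have "L * norm (x - w) \<le> L * (dist x y + norm (y - w))"
      using L dist_triangle[of x w y] by (intro mult_left_mono) (auto simp: dist_norm)
    ultimately show "lipschitz_envelope f U L x - lipschitz_envelope f U L y \<le> L * dist x y + e"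
      using w(2) by (simp add: distrib_left)
  qed
  show "dist (lipschitz_envelope f U L x) (lipschitz_envelope f U L y) \<le> L * dist x y" for x y
    using *[of x y] *[of y x] by (simp add: dist_real_def dist_commute abs_le_iff)
qed (rule L)

lemma convex_on_lipschitz_envelope:
  assumes "convex_on U f"
  shows "convex_on UNIV (lipschitz_envelope f U L)"
  unfolding convex_on_def
proof (intro conjI ballI allI impI)
  fix x y :: 'a and s t :: real
  assume st: "0 \<le> s" "0 \<le> t" "s + t = 1"
  let ?g = "lipschitz_envelope f U L"
  show "?g (s *\<^sub>R x + t *\<^sub>R y) \<le> s * ?g x + t * ?g y"
  proof (rule field_le_epsilon)
    fix e :: real assume "0 < e"
    obtain v where v: "v \<in> U" "f v + L * norm (x - v) < ?g x + e"
      using lipschitz_envelope_approx[OF \<open>0 < e\<close>] by blast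
    obtain w where w: "w \<in> U" "f w + L * norm (y - w) < ?g y + e"
      using lipschitz_envelope_approx[OF \<open>0 < e\<close>] by blast
    have "s *\<^sub>R v + t *\<^sub>R w \<in> U"
      using assms v(1) w(1) st by (auto simp: convex_on_def convex_def)
    from lipschitz_envelope_le[OF this]
    have "?g (s *\<^sub>R x + t *\<^sub>R y) \<le> f (s *\<^sub>R v + t *\<^sub>R w) + L * norm (s *\<^sub>R x + t *\<^sub>R y - (s *\<^sub>R v + t *\<^sub>R w))" .
    also have "\<dots> \<le> (s * f v + t * f w) + L * (s * norm (x - v) + t * norm (y - w))"
    proof (intro add_mono mult_left_mono L)
      show "f (s *\<^sub>R v + t *\<^sub>R w) \<le> s * f v + t * f w"
        using assms v(1) w(1) st by (auto simp: convex_on_def)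
      have "s *\<^sub>R x + t *\<^sub>R y - (s *\<^sub>R v + t *\<^sub>R w) = s *\<^sub>R (x - v) + t *\<^sub>R (y - w)"
        by (simp add: algebra_simps)
      also have "norm \<dots> \<le> s * norm (x - v) + t * norm (y - w)"
        using st norm_triangle_ineq[of "s *\<^sub>R (x - v)" "t *\<^sub>R (y - w)"] by simp
      finally show "norm (s *\<^sub>R x + t *\<^sub>R y - (s *\<^sub>R v + t *\<^sub>R w)) \<le> s * norm (x - v) + t * norm (y - w)" .
    qed
    also have "\<dots> = s * (f v + L * norm (x - v)) + t * (f w + L * norm (y - w))"
      by (simp add: algebra_simps)
    also have "\<dots> \<le> s * (?g x + e) + t * (?g y + e)"
      using v(2) w(2) st by (intro add_mono[of "s * _"] mult_left_mono) auto
    also have "\<dots> = s * ?g x + t * ?g y + (s + t) * e"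
      by (simp add: algebra_simps)
    finally show "?g (s *\<^sub>R x + t *\<^sub>R y) \<le> s * ?g x + t * ?g y + e"
      using st by simp
  qed
qed simp

end

section \<open>Gluing by smooth maxima\<close>

lemma C_on_iff_Ck_on: "C_on m V f \<longleftrightarrow> (\<forall>k. enat k \<le> m \<longrightarrow> Ck_on k V f)"
proof (cases m)
  case (enat l)
  then show ?thesis
    using mlin_Ck_mono[of l 0 V "\<lambda>x _. f x"] by (auto simp: C_on_def Ck_on_iff_mlin_Ck)
qed (simp add: C_on_def)

lemma C_on_soft_max:
  assumes "0 < c" "C_on m V u" "C_on m V w"
  shows "C_on m V (\<lambda>x. soft_max c (u x) (w x))"
  unfolding C_on_iff_Ck_on
proof (intro allI impI)
  fix k assume "enat k \<le> m"
  with assms have u: "mlin_Ck k 0 V (\<lambda>x _. u x)" and w: "mlin_Ck k 0 V (\<lambda>x _. w x)"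
    by (auto simp: C_on_iff_Ck_on Ck_on_iff_mlin_Ck)
  obtain F where F: "F 0 = soft_ramp c" "\<And>n t. (F n has_real_derivative F (Suc n) t) (at t)"
    using soft_ramp_smooth[OF assms(1)] by blast
  have "((\<lambda>t. F n (t + c)) has_real_derivative F (Suc n) (t + c)) (at t)" for n t
    using F(2)[of n "t + c"] by (simp add: DERIV_shift)
  moreover have "mlin_Ck k 0 V (\<lambda>x _. w x - u x)"
    using mlin_Ck_add[OF w mlin_Ck_minus[OF u]] by simp
  ultimately have "mlin_Ck k 0 V (\<lambda>x _. F 0 (w x - u x + c))"
    using mlin_Ck_compose[of "\<lambda>n t. F n (t + c)" k V "\<lambda>x. w x - u x" 0] by simp
  from mlin_Ck_add[OF u this] show "Ck_on k V (\<lambda>x. soft_max c (u x) (w x))"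
    by (simp add: F Ck_on_iff_mlin_Ck soft_max_def)
qed

text \<open>
  Near every point of \<open>U\<close> the limit equals one of the \<open>G i\<close>, hence it is as smooth as
  they are; any three points of \<open>U\<close> lie in a common \<open>E i\<close>, hence the limit is convex.
\<close>
lemma eventually_constant_limit:
  fixes G :: "nat \<Rightarrow> 'a::real_normed_vector \<Rightarrow> real"
  assumes U: "convex U" and E: "\<And>i. E i \<subseteq> E (Suc i)" "\<And>i. E i \<subseteq> U" "\<And>x. x \<in> U \<Longrightarrow> \<exists>i. x \<in> interior (E i)"
    and G: "\<And>i. convex_on UNIV (G i)" "\<And>i. C_on m UNIV (G i)"
    and stable: "\<And>i x. x \<in> E i \<Longrightarrow> G (Suc i) x = G i x"
  obtains g where "convex_on U g" "C_on m U g" "\<And>i x. x \<in> E i \<Longrightarrow> g x = G i x"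
proof -
  have E_mono: "E i \<subseteq> E j" if "i \<le> j" for i j
    using that E(1) by (rule lift_Suc_mono_le[rotated])
  have G_stable: "G j x = G i x" if "i \<le> j" "x \<in> E i" for i j x
    using that(1)
  proof (induction rule: dec_induct)
    case (step n)
    then have "x \<in> E n" using that(2) E_mono by blast
    with step.IH show ?case by (simp add: stable)
  qed simp
  define g where "g x = G (LEAST i. x \<in> E i) x" for x
  have g: "g x = G i x" if "x \<in> E i" for i x
    unfolding g_def using G_stable[of "LEAST i. x \<in> E i" i x] LeastI[of "\<lambda>i. x \<in> E i" i]
      Least_le[of "\<lambda>i. x \<in> E i" i] that by auto
  have ex: "\<exists>i. x \<in> E i" if "x \<in> U" for x
    using E(3)[OF that] interior_subset by blast
  have "convex_on U g"
    unfolding convex_on_def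
  proof (intro conjI ballI allI impI U)
    fix x y and s t :: real
    assume *: "x \<in> U" "y \<in> U" "0 \<le> s" "0 \<le> t" "s + t = 1"
    let ?z = "s *\<^sub>R x + t *\<^sub>R y"
    have "?z \<in> U" using * U by (simp add: convex_def)
    then obtain i1 i2 i3 where "x \<in> E i1" "y \<in> E i2" "?z \<in> E i3"
      using ex * by meson
    then have "x \<in> E (i1 + i2 + i3)" "y \<in> E (i1 + i2 + i3)" "?z \<in> E (i1 + i2 + i3)"
      using E_mono[of i1 "i1 + i2 + i3"] E_mono[of i2 "i1 + i2 + i3"] E_mono[of i3 "i1 + i2 + i3"] by auto
    then show "g ?z \<le> s * g x + t * g y"
      using G(1)[of "i1 + i2 + i3"] * by (simp add: g convex_on_def)
  qed
  moreover have "C_on m U g"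
    unfolding C_on_iff_Ck_on
  proof (intro allI impI)
    fix k assume k: "enat k \<le> m"
    have "mlin_Ck k 0 W (\<lambda>x _. g x)" if "W \<in> range (\<lambda>i. interior (E i))" for W
    proof -
      from that obtain i where i: "W = interior (E i)" by blast
      have "mlin_Ck k 0 W (\<lambda>x _. G i x)"
        using G(2)[of i] k by (auto simp: C_on_iff_Ck_on Ck_on_iff_mlin_Ck intro: mlin_Ck_subset[of W UNIV])
      then show ?thesis
        by (rule mlin_Ck_cong[rotated]) (use g i interior_subset[of "E i"] in auto)
    qed
    then have "mlin_Ck k 0 (\<Union>i. interior (E i)) (\<lambda>x _. g x)"
      by (intro mlin_Ck_Union) auto
    moreover have "(\<Union>i. interior (E i)) = U"
    proof
      show "(\<Union>i. interior (E i)) \<subseteq> U"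
        using subset_trans[OF interior_subset E(2)] by blast
    qed (use E(3) in auto)
    ultimately show "Ck_on k U g" by (simp add: Ck_on_iff_mlin_Ck)
  qed
  ultimately show ?thesis using that g by blast
qed

theorem theorem1p2:
  fixes m :: enat
  assumes "1 \<le> m"
    and "\<forall>f :: 'a::banach \<Rightarrow> real. \<forall>\<epsilon>>0.
      convex_on UNIV f \<and> (\<exists>L. lipschitz_on L UNIV f) \<longrightarrow>
      (\<exists>h :: 'a \<Rightarrow> real. convex_on UNIV h \<and> C_on m UNIV h \<and> (\<forall>x. \<bar>f x - h x\<bar> \<le> \<epsilon>))"
  shows "\<forall>(U :: 'a set) (f :: 'a \<Rightarrow> real). \<forall>\<epsilon>>0.
      open U \<and> convex U \<and> convex_on U f \<and> continuous_on U f \<longrightarrow>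
      (\<exists>g :: 'a \<Rightarrow> real. convex_on U g \<and> C_on m U g \<and> (\<forall>x\<in>U. \<bar>f x - g x\<bar> \<le> \<epsilon>))"
proof (intro allI impI, elim conjE)
  fix U :: "'a set" and f :: "'a \<Rightarrow> real" and \<epsilon> :: real
  assume \<epsilon>: "0 < \<epsilon>" and U: "open U" "convex U" and f: "convex_on U f" "continuous_on U f"
  show "\<exists>g :: 'a \<Rightarrow> real. convex_on U g \<and> C_on m U g \<and> (\<forall>x\<in>U. \<bar>f x - g x\<bar> \<le> \<epsilon>)"
  proof (cases "U = {}")
    case True
    have "C_on m U (\<lambda>_. 0 :: real)"
      unfolding C_on_iff_Ck_on Ck_on_def frechet_derivs_upto_def True by simp
    then show ?thesis
      using True by (intro exI[of _ "\<lambda>_. 0"]) (auto simp: convex_on_def)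
  next
    case False
    then obtain x0 where x0: "x0 \<in> U" by blast
    obtain L0 where L0: "\<And>M. L0 \<le> M \<Longrightarrow> x0 \<in> interior (slope_region f U M)"
      using interior_slope_region_cover[OF U(1) f x0] by blast
    \<comment> \<open>start with a slope for which the region contains \<open>x0\<close>, so that all envelopes are finite\<close>
    define L where "L i = max 0 L0 + real i" for i
    define E where "E i = slope_region f U (L i)" for i
    define \<phi> where "\<phi> i = lipschitz_envelope f U (L i)" for i
    \<comment> \<open>offsets that decrease with \<open>i\<close>: on \<open>E i\<close> the function \<open>h i\<close> below beats \<open>h (Suc i)\<close> by more than \<open>a i / 4\<close>\<close>
    define a where "a i = \<epsilon> / 2 ^ Suc i" for i
    have L: "0 \<le> L i" for i by (simp add: L_def)
    have ne: "slope_region f U (L i) \<noteq> {}" for i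
    proof -
      have "L0 \<le> L i" by (simp add: L_def)
      then show ?thesis using L0 interior_subset by blast
    qed
    have a: "0 < a i" "a (Suc i) = a i / 2" for i using \<epsilon> by (auto simp: a_def)
    have a_le: "a i \<le> a 0" for i
    proof (induction i)
      case (Suc i)
      with a[of i] show ?case by simp
    qed simp
    have E_Suc: "E i \<subseteq> E (Suc i)" for i
      unfolding E_def by (rule slope_region_mono) (simp add: L_def)
    have E_U: "E i \<subseteq> U" for i by (auto simp: E_def slope_region_def)
    have E_cover: "\<exists>i. x \<in> interior (E i)" if "x \<in> U" for x
    proof -
      obtain K where K: "\<And>M. K \<le> M \<Longrightarrow> x \<in> interior (slope_region f U M)"
        using interior_slope_region_cover[OF U(1) f \<open>x \<in> U\<close>] by blast
      obtain i where "K \<le> real i" using real_arch_simple by blast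
      then have "K \<le> L i" by (simp add: L_def)
      with K show ?thesis by (auto simp: E_def)
    qed
    have "\<exists>h. convex_on UNIV h \<and> C_on m UNIV h \<and> (\<forall>x. \<bar>\<phi> i x + a i - h x\<bar> \<le> a i / 8)" for i
    proof -
      have "convex_on UNIV (\<lambda>x. \<phi> i x + a i)"
        unfolding \<phi>_def by (intro convex_on_add convex_on_lipschitz_envelope ne L f) (simp add: convex_on_def flip: distrib_right)
      moreover have "lipschitz_on (L i) UNIV (\<lambda>x. \<phi> i x + a i)"
        using lipschitz_on_envelope[OF ne L, of i] by (simp add: \<phi>_def lipschitz_on_def)
      moreover have "0 < a i / 8" using a by simp
      ultimately show ?thesis using assms(2) by blast
    qed
    then obtain h where h: "\<And>i. convex_on UNIV (h i)" "\<And>i. C_on m UNIV (h i)"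
      "\<And>i x. \<bar>\<phi> i x + a i - h i x\<bar> \<le> a i / 8" by metis
    have h_upper: "h i x \<le> f x + 9 / 8 * a i" if "x \<in> U" for i x
      using h(3)[of i x] lipschitz_envelope_le_self[OF ne L that, of i] unfolding \<phi>_def by linarith
    have h_lower: "f x + 7 / 8 * a i \<le> h i x" if "x \<in> E i" for i x
      using h(3)[of i x] lipschitz_envelope_eq[OF ne L that[unfolded E_def]] unfolding \<phi>_def by linarith
    define G where "G = rec_nat (h 0) (\<lambda>i g x. soft_max (a i / 4) (g x) (h (Suc i) x))"
    have G0: "G 0 = h 0" and GS: "G (Suc i) = (\<lambda>x. soft_max (a i / 4) (G i x) (h (Suc i) x))" for i
      by (simp_all add: G_def)
    have a4: "0 < a i / 4" for i using a by simp
    have G_convex: "convex_on UNIV (G i)" for i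
      by (induction i) (simp_all add: G0 GS h convex_on_soft_max[OF a4])
    have G_smooth: "C_on m UNIV (G i)" for i
      by (induction i) (simp_all add: G0 GS h C_on_soft_max[OF a4])
    have G_ge: "h i x \<le> G i x" for i x
      by (cases i) (simp_all add: G0 GS soft_max_ge[OF a4])
    have G_le: "G i x \<le> f x + \<epsilon>" if "x \<in> U" for i x
    proof (induction i)
      case 0
      have "9 / 8 * a 0 \<le> \<epsilon>" using \<epsilon> by (simp add: a_def)
      with h_upper[OF that, of 0] show ?case by (simp add: G0)
    next
      case (Suc i)
      \<comment> \<open>the width \<open>a i / 4\<close> of the soft maximum fits below \<open>f x + \<epsilon>\<close>, so the errors do not accumulate\<close>
      have "h (Suc i) x + a i / 4 \<le> f x + \<epsilon>"
        using h_upper[OF that, of "Suc i"] a(2)[of i] a_le[of i] a(1)[of i] \<epsilon> by (simp add: a_def[of 0])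
      with Suc soft_max_le[OF a4, of i "G i x" "h (Suc i) x"] show ?case by (simp add: GS)
    qed
    \<comment> \<open>on \<open>E i\<close>: \<open>h (Suc i) + a i / 4 \<le> f + 13/16 * a i \<le> f + 7/8 * a i \<le> h i \<le> G i\<close>\<close>
    have G_stable: "G (Suc i) x = G i x" if "x \<in> E i" for i x
      unfolding GS
    proof (rule soft_max_eq_left)
      have "x \<in> U" using that E_U by blast
      then show "h (Suc i) x + a i / 4 \<le> G i x"
        using h_upper[of x "Suc i"] h_lower[OF that] G_ge[of i x] a[of i] by simp
    qed
    obtain g where g: "convex_on U g" "C_on m U g" "\<And>i x. x \<in> E i \<Longrightarrow> g x = G i x"
      using eventually_constant_limit[where E = E and G = G, OF U(2) E_Suc E_U E_cover G_convex G_smooth G_stable] by blast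
    have "\<bar>f x - g x\<bar> \<le> \<epsilon>" if x: "x \<in> U" for x
    proof -
      obtain i where i: "x \<in> E i" using E_cover[OF x] interior_subset by blast
      show ?thesis
        using G_le[OF x, of i] h_lower[OF i] G_ge[of i x] a(1)[of i] \<epsilon> unfolding g(3)[OF i] by simp
    qed
    with g show ?thesis by blast
  qed
qed

end
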